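(* Let $M[P,Q]$ be connected, of rank $r$ and nullity $m$. Let the $EN$ corners of $Q$ be at $i_1<i_2<\cdots<i_h$ and the $NE$ corners of $P$ be at $j_1-1<j_2-1<\cdots<j_k-1$. Then the fundamental flats of $M[P,Q]$ are exactly $[i_1]\subset[i_2]\subset\cdots\subset[i_h]$ and $[j_k,m+r]\subset\cdots\subset[j_2,m+r]\subset[j_1,m+r]$.
   Context: Lattice paths start at $(0,0)$ and use steps $E=(1,0)$ and $N=(0,1)$, written as words in $\{E,N\}$; "step $j$" is the $j$-th letter. A path has an $NE$ corner at $h$ if step $h$ is $N$ and step $h+1$ is $E$, and an $EN$ corner at $h$ if step $h$ is $E$ and step $h+1$ is $N$. For lattice paths $P,Q$ from $(0,0)$ to $(m,r)$ with $P$ never going above $Q$, let $\mathcal{P}$ be the set of lattice paths from $(0,0)$ to $(m,r)$ going neither above $Q$ nor below $P$, and for $1\le i\le r$ let $N_i=\{j:\text{step } j \text{ is the } i\text{-th North step of some path in }\mathcal{P}\}$. $M[P,Q]$ is the transversal matroid on $[m+r]$ with presentation $(N_1,\ldots,N_r)$. $[a]=\{1,\ldots,a\}$, $[b,c]=\{b,\ldots,c\}$. A fundamental flat of a connected matroid $M$ is a flat $X$ with $M|X$ connected, $|X|>1$, $r(X)<r(M)$, such that for some spanning circuit $C$ of $M$, $X\cap C$ is a basis of $M|X$. *)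

theory Defs
  imports Main
begin

section \<open>Matroids\<close>

text \<open>The record carries only the data; \<open>matroid\<close> states the axioms.  The notions below are
  the usual ones for finite matroids, given by their independent sets.\<close>

record 'a indep_system =
  ground :: "'a set"
  indep :: "'a set \<Rightarrow> bool"

definition matroid :: "'a indep_system \<Rightarrow> bool" where
  "matroid M \<longleftrightarrow>
     finite (ground M) \<and>
     (\<forall>I. indep M I \<longrightarrow> I \<subseteq> ground M) \<and>
     indep M {} \<and>
     (\<forall>I J. indep M J \<longrightarrow> I \<subseteq> J \<longrightarrow> indep M I) \<and>
     (\<forall>I J. indep M I \<longrightarrow> indep M J \<longrightarrow> card I < card J \<longrightarrow>
        (\<exists>x \<in> J - I. indep M (insert x I)))"

definition basis :: "'a indep_system \<Rightarrow> 'a set \<Rightarrow> bool" where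
  "basis M B \<longleftrightarrow> indep M B \<and> (\<forall>B'. indep M B' \<longrightarrow> B \<subseteq> B' \<longrightarrow> B' = B)"

definition rank :: "'a indep_system \<Rightarrow> 'a set \<Rightarrow> nat" where
  "rank M X = Max (card ` {I. I \<subseteq> X \<and> indep M I})"

abbreviation matroid_rank :: "'a indep_system \<Rightarrow> nat" where
  "matroid_rank M \<equiv> rank M (ground M)"

definition nullity :: "'a indep_system \<Rightarrow> nat" where
  "nullity M = card (ground M) - matroid_rank M"

definition circuit :: "'a indep_system \<Rightarrow> 'a set \<Rightarrow> bool" where
  "circuit M C \<longleftrightarrow> C \<subseteq> ground M \<and> \<not> indep M C \<and> (\<forall>D. D \<subset> C \<longrightarrow> indep M D)"

definition spanning :: "'a indep_system \<Rightarrow> 'a set \<Rightarrow> bool" where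
  "spanning M X \<longleftrightarrow> X \<subseteq> ground M \<and> rank M X = matroid_rank M"

definition flat :: "'a indep_system \<Rightarrow> 'a set \<Rightarrow> bool" where
  "flat M X \<longleftrightarrow> X \<subseteq> ground M \<and> (\<forall>x \<in> ground M - X. rank M X < rank M (insert x X))"

definition restriction :: "'a indep_system \<Rightarrow> 'a set \<Rightarrow> 'a indep_system" where
  "restriction M X = \<lparr>ground = ground M \<inter> X, indep = (\<lambda>I. I \<subseteq> X \<and> indep M I)\<rparr>"

text \<open>Connectedness in Oxley's form, equivalent to not being a direct sum of two nonempty
  matroids; with at most one element it holds trivially.\<close>

definition connected_matroid :: "'a indep_system \<Rightarrow> bool" where
  "connected_matroid M \<longleftrightarrow>
     (\<forall>x \<in> ground M. \<forall>y \<in> ground M. x \<noteq> y \<longrightarrow> (\<exists>C. circuit M C \<and> x \<in> C \<and> y \<in> C))"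

definition fundamental_flat :: "'a indep_system \<Rightarrow> 'a set \<Rightarrow> bool" where
  "fundamental_flat M X \<longleftrightarrow>
     flat M X \<and> connected_matroid (restriction M X) \<and> card X > 1 \<and>
     rank M X < matroid_rank M \<and>
     (\<exists>C. circuit M C \<and> spanning M C \<and> basis (restriction M X) (X \<inter> C))"


section \<open>Transversal matroids\<close>

definition partial_transversal :: "'i set \<Rightarrow> ('i \<Rightarrow> 'a set) \<Rightarrow> 'a set \<Rightarrow> bool" where
  "partial_transversal J A I \<longleftrightarrow>
     (\<exists>\<phi>. inj_on \<phi> I \<and> \<phi> ` I \<subseteq> J \<and> (\<forall>x \<in> I. x \<in> A (\<phi> x)))"

definition transversal_matroid :: "'a set \<Rightarrow> 'i set \<Rightarrow> ('i \<Rightarrow> 'a set) \<Rightarrow> 'a indep_system" where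
  "transversal_matroid S J A =
     \<lparr>ground = S, indep = (\<lambda>I. I \<subseteq> S \<and> partial_transversal J A I)\<rparr>"

lemma partial_transversal_augment:
  assumes "finite I" "finite K"
    and "inj_on \<phi> I" "\<phi> ` I \<subseteq> J" "\<forall>x \<in> I. x \<in> A (\<phi> x)"
    and \<psi>: "inj_on \<psi> K" "\<psi> ` K \<subseteq> J" "\<forall>x \<in> K. x \<in> A (\<psi> x)"
    and "card I < card K"
  shows "\<exists>x \<in> K - I. partial_transversal J A (insert x I)"
  using assms(3-5)
proof (induction "card {x \<in> I \<inter> K. \<phi> x \<noteq> \<psi> x}" arbitrary: \<phi> rule: less_induct)
  case less
  have "card (\<phi> ` I) < card (\<psi> ` K)"
    using less.prems(1) \<psi>(1) \<open>card I < card K\<close> by (simp add: card_image)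
  then have "\<not> \<psi> ` K \<subseteq> \<phi> ` I"
    using \<open>finite I\<close> by (meson card_mono finite_imageI not_le)
  then obtain x where x: "x \<in> K" "\<psi> x \<notin> \<phi> ` I" by blast
  let ?\<phi> = "\<phi>(x := \<psi> x)"
  have inj: "inj_on ?\<phi> (insert x I)"
  proof (subst inj_on_insert, intro conjI)
    show "inj_on ?\<phi> I"
      using less.prems(1) x(2) by (rule inj_on_fun_updI)
    show "?\<phi> x \<notin> ?\<phi> ` (I - {x})"
      using x(2) by (simp add: image_iff)
  qed
  have ran: "?\<phi> ` insert x I \<subseteq> J" "\<forall>y \<in> insert x I. y \<in> A (?\<phi> y)"
    using less.prems \<psi> x by auto
  show ?case
  proof (cases "x \<in> I")
    case False
    then show ?thesis
      using x inj ran unfolding partial_transversal_def by blast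
  next
    case True
    have "{y \<in> I \<inter> K. ?\<phi> y \<noteq> \<psi> y} \<subset> {y \<in> I \<inter> K. \<phi> y \<noteq> \<psi> y}"
      using True x by force
    then have "card {y \<in> I \<inter> K. ?\<phi> y \<noteq> \<psi> y} < card {y \<in> I \<inter> K. \<phi> y \<noteq> \<psi> y}"
      using \<open>finite I\<close> by (intro psubset_card_mono) auto
    then show ?thesis
      using inj ran unfolding insert_absorb[OF True] by (rule less.hyps)
  qed
qed

lemma matroid_transversal_matroid:
  assumes "finite S"
  shows "matroid (transversal_matroid S J A)"
proof -
  have sub: "partial_transversal J A I" if K: "partial_transversal J A K" and IK: "I \<subseteq> K" for I K
  proof -
    obtain \<phi> where \<phi>: "inj_on \<phi> K" "\<phi> ` K \<subseteq> J" "\<forall>x \<in> K. x \<in> A (\<phi> x)"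
      using K unfolding partial_transversal_def by (elim exE conjE) (rule that)
    have "inj_on \<phi> I"
      using \<phi>(1) IK by (rule inj_on_subset)
    moreover have "\<phi> ` I \<subseteq> J" "\<forall>x \<in> I. x \<in> A (\<phi> x)"
      using \<phi>(2,3) IK by auto
    ultimately show ?thesis
      unfolding partial_transversal_def by (intro exI[of _ \<phi>] conjI)
  qed
  have aug: "\<exists>x \<in> K - I. insert x I \<subseteq> S \<and> partial_transversal J A (insert x I)"
    if "I \<subseteq> S" "K \<subseteq> S" and I: "partial_transversal J A I" and K: "partial_transversal J A K"
      and "card I < card K"
    for I K
  proof -
    have fin: "finite I" "finite K"
      using that(1,2) assms by (auto dest: finite_subset)
    obtain \<phi> where \<phi>: "inj_on \<phi> I" "\<phi> ` I \<subseteq> J" "\<forall>x \<in> I. x \<in> A (\<phi> x)"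
      using I unfolding partial_transversal_def by (elim exE conjE) (rule that)
    obtain \<psi> where \<psi>: "inj_on \<psi> K" "\<psi> ` K \<subseteq> J" "\<forall>x \<in> K. x \<in> A (\<psi> x)"
      using K unfolding partial_transversal_def by (elim exE conjE) (rule that)
    show ?thesis
      using partial_transversal_augment[OF fin \<phi> \<psi> that(5)] that(1,2) by blast
  qed
  show ?thesis
    unfolding matroid_def transversal_matroid_def indep_system.simps
  proof (intro conjI allI impI)
    show "finite S" by (rule assms)
    show "{} \<subseteq> S" by simp
    show "partial_transversal J A {}"
      by (simp add: partial_transversal_def)
    show "I \<subseteq> S" if "I \<subseteq> S \<and> partial_transversal J A I" for I
      using that by (rule conjunct1)
    show "I \<subseteq> S" if "K \<subseteq> S \<and> partial_transversal J A K" "I \<subseteq> K" for I K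
      using that by (meson subset_trans)
    show "partial_transversal J A I" if "K \<subseteq> S \<and> partial_transversal J A K" "I \<subseteq> K" for I K
      using conjunct2[OF that(1)] that(2) by (rule sub)
    show "\<exists>x \<in> K - I. insert x I \<subseteq> S \<and> partial_transversal J A (insert x I)"
      if "I \<subseteq> S \<and> partial_transversal J A I" "K \<subseteq> S \<and> partial_transversal J A K"
        "card I < card K" for I K
      using that by (intro aug) (erule conjE | assumption)+
  qed
qed


section \<open>Lattice paths\<close>

datatype step = E | N

text \<open>A lattice path is its word of steps and starts at \<open>(0, 0)\<close>.  Steps are numbered from 1, so
  step \<open>j\<close> of \<open>w\<close> is \<open>w ! (j - 1)\<close>; \<open>vertex w t\<close> is the point reached after \<open>t\<close> steps.\<close>

definition vertex :: "step list \<Rightarrow> nat \<Rightarrow> nat \<times> nat" where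
  "vertex w t = (count_list (take t w) E, count_list (take t w) N)"

definition vertices :: "step list \<Rightarrow> (nat \<times> nat) set" where
  "vertices w = vertex w ` {0..length w}"

definition lattice_path_to :: "nat \<times> nat \<Rightarrow> step list \<Rightarrow> bool" where
  "lattice_path_to p w \<longleftrightarrow> vertex w (length w) = p"

text \<open>Positions are compared along vertical lines: \<open>R\<close> goes above \<open>Q\<close> if some vertex of \<open>R\<close> is
  strictly higher than every vertex of \<open>Q\<close> in the same column.  Only used for paths with a common
  endpoint, where every column met by one path is met by the other.\<close>

definition goes_above :: "step list \<Rightarrow> step list \<Rightarrow> bool" where
  "goes_above R Q \<longleftrightarrow>
     (\<exists>x y. (x, y) \<in> vertices R \<and> (\<forall>y'. (x, y') \<in> vertices Q \<longrightarrow> y' < y))"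

definition goes_below :: "step list \<Rightarrow> step list \<Rightarrow> bool" where
  "goes_below R P \<longleftrightarrow>
     (\<exists>x y. (x, y) \<in> vertices R \<and> (\<forall>y'. (x, y') \<in> vertices P \<longrightarrow> y < y'))"

definition NE_corner :: "step list \<Rightarrow> nat \<Rightarrow> bool" where
  "NE_corner w h \<longleftrightarrow> 1 \<le> h \<and> h + 1 \<le> length w \<and> w ! (h - 1) = N \<and> w ! h = E"

definition EN_corner :: "step list \<Rightarrow> nat \<Rightarrow> bool" where
  "EN_corner w h \<longleftrightarrow> 1 \<le> h \<and> h + 1 \<le> length w \<and> w ! (h - 1) = E \<and> w ! h = N"

definition is_north_step :: "step list \<Rightarrow> nat \<Rightarrow> nat \<Rightarrow> bool" where
  "is_north_step w i j \<longleftrightarrow>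
     1 \<le> j \<and> j \<le> length w \<and> w ! (j - 1) = N \<and> count_list (take j w) N = i"


section \<open>Lattice path matroids\<close>

definition paths_between :: "nat \<Rightarrow> nat \<Rightarrow> step list \<Rightarrow> step list \<Rightarrow> step list set" where
  "paths_between m r P Q = {R. lattice_path_to (m, r) R \<and> \<not> goes_above R Q \<and> \<not> goes_below R P}"

definition north_set :: "nat \<Rightarrow> nat \<Rightarrow> step list \<Rightarrow> step list \<Rightarrow> nat \<Rightarrow> nat set" where
  "north_set m r P Q i = {j. \<exists>R \<in> paths_between m r P Q. is_north_step R i j}"

definition lattice_path_matroid ::
    "nat \<Rightarrow> nat \<Rightarrow> step list \<Rightarrow> step list \<Rightarrow> nat indep_system" where
  "lattice_path_matroid m r P Q = transversal_matroid {1..m + r} {1..r} (north_set m r P Q)"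

lemma matroid_lattice_path_matroid: "matroid (lattice_path_matroid m r P Q)"
  unfolding lattice_path_matroid_def by (simp add: matroid_transversal_matroid)

end

theory Submission
  imports Defs
begin

text \<open>Let \<open>a t\<close> and \<open>b t\<close> be the heights of \<open>P\<close> and \<open>Q\<close> after \<open>t\<close> steps.  The \<open>N_i\<close> are intervals, so by
  Hall's theorem \<open>I\<close> is independent iff \<open>\<bar>I \<inter> {s<..t}\<bar> \<le> b t - a s\<close> for all \<open>s \<le> t\<close>, and connectedness
  makes the paths disjoint except at their ends.  Let \<open>C\<close> be a spanning circuit meeting a
  fundamental flat \<open>X\<close> in a basis \<open>B\<close>.  Since \<open>C\<close> leaves slack in all these inequalities except those
  with \<open>s\<close> before or \<open>t\<close> after \<open>C\<close>, \<open>B\<close> spans only an initial segment, a final segment and \<open>B\<close> itself.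
  No circuit in \<open>X\<close> meets two of these parts, so \<open>X\<close> is a segment; being flat and connected, it ends
  or begins at a corner.  Conversely the North steps of \<open>Q\<close> and the last element form a spanning circuit
  that serves all initial segments, and a half turn of the picture gives the final ones.\<close>

section \<open>Matroid preliminaries\<close>

lemma rank_eqI:
  assumes "finite X" "I \<subseteq> X" "indep M I" "card I = k"
    and "\<And>J. J \<subseteq> X \<Longrightarrow> indep M J \<Longrightarrow> card J \<le> k"
  shows "rank M X = k"
  unfolding rank_def using assms by (intro Max_eqI) auto

lemma rank_ge:
  assumes "finite X" "I \<subseteq> X" "indep M I"
  shows "card I \<le> rank M X"
  unfolding rank_def using assms by (intro Max_ge) auto

lemma rank_attained:
  assumes "finite X" "indep M {}"
  obtains I where "I \<subseteq> X" "indep M I" "card I = rank M X"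
proof -
  have "rank M X \<in> card ` {I. I \<subseteq> X \<and> indep M I}"
    unfolding rank_def using assms by (intro Max_in) auto
  then show ?thesis using that by auto
qed

lemma
  assumes "matroid M"
  shows matroid_finite: "finite (ground M)"
    and matroid_subset_ground: "indep M I \<Longrightarrow> I \<subseteq> ground M"
    and matroid_empty: "indep M {}"
    and matroid_subset: "indep M J \<Longrightarrow> I \<subseteq> J \<Longrightarrow> indep M I"
    and matroid_augment: "indep M I \<Longrightarrow> indep M J \<Longrightarrow> card I < card J \<Longrightarrow>
      \<exists>x \<in> J - I. indep M (insert x I)"
  using assms unfolding matroid_def by simp_all

lemma circuit_subset_exists:
  assumes "finite K" "K \<subseteq> ground M" "\<not> indep M K"
  obtains C where "circuit M C" "C \<subseteq> K"
proof -
  have "finite {C. C \<subseteq> K \<and> \<not> indep M C}" "K \<in> {C. C \<subseteq> K \<and> \<not> indep M C}"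
    using assms by auto
  then obtain C where C: "C \<subseteq> K" "\<not> indep M C"
      and min: "\<And>D. D \<subseteq> K \<Longrightarrow> \<not> indep M D \<Longrightarrow> D \<subseteq> C \<Longrightarrow> D = C"
    using finite_has_minimal2[of "{C. C \<subseteq> K \<and> \<not> indep M C}" K]
    by (smt (verit) mem_Collect_eq)
  have "circuit M C"
    unfolding circuit_def
  proof (intro conjI allI impI)
    show "indep M D" if "D \<subset> C" for D using min[of D] C(1) that by auto
  qed (use C assms(2) in auto)
  then show ?thesis using that C(1) by blast
qed

text \<open>A circuit inside the dependent set \<open>insert x B\<close> lies in neither of the two
  independent sets: leaving \<open>B\<close> it contains \<open>x\<close>, and leaving
  \<open>insert x (B - {y})\<close> it contains \<open>y\<close>. Connectedness thus reduces to
  finding exchange pairs.\<close>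

lemma circuit_through_exchange:
  assumes "matroid M" "indep M B" "indep M (insert x (B - {y}))" "\<not> indep M (insert x B)"
  obtains C where "circuit M C" "x \<in> C" "y \<in> C" "C \<subseteq> insert x B"
proof -
  have sub: "insert x B \<subseteq> ground M"
    using matroid_subset_ground[OF assms(1,2)] matroid_subset_ground[OF assms(1,3)] by blast
  then have "finite (insert x B)"
    using matroid_finite[OF assms(1)] by (rule finite_subset)
  then obtain C where C: "circuit M C" "C \<subseteq> insert x B"
    using sub assms(4) by (rule circuit_subset_exists)
  have "\<not> C \<subseteq> B" "\<not> C \<subseteq> insert x (B - {y})"
    using C(1) matroid_subset[OF assms(1,2)] matroid_subset[OF assms(1,3)]
    unfolding circuit_def by blast+
  then show ?thesis using that C by blast
qed

lemma circuit_restriction_iff: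
  "circuit (restriction M X) C \<longleftrightarrow> circuit M C \<and> C \<subseteq> X"
  unfolding circuit_def restriction_def by auto

text \<open>A maximum independent subset of \<open>insert y X\<close> is larger than
  \<open>B\<close>, so it augments \<open>B\<close>. The new element cannot lie in \<open>X\<close>,
  where \<open>B\<close> is maximal, so it is \<open>y\<close>.\<close>

lemma matroid_basis_restriction_insert:
  assumes "matroid M" "finite X" "basis (restriction M X) B" "rank M X < rank M (insert y X)"
  shows "indep M (insert y B)"
proof -
  have B: "indep M B" "B \<subseteq> X" "\<And>B'. indep M B' \<Longrightarrow> B' \<subseteq> X \<Longrightarrow> B \<subseteq> B' \<Longrightarrow> B' = B"
    using assms(3) unfolding basis_def restriction_def by auto
  obtain J where J: "J \<subseteq> insert y X" "indep M J" "card J = rank M (insert y X)"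
    using rank_attained[of "insert y X" M] matroid_empty[OF assms(1)] assms(2) by auto
  have "card B < card J"
    using rank_ge[OF assms(2) B(2,1)] J(3) assms(4) by linarith
  then obtain e where e: "e \<in> J - B" "indep M (insert e B)"
    using matroid_augment[OF assms(1) B(1) J(2)] by blast
  then have "e \<notin> X" using B by blast
  then show ?thesis using e J(1) by auto
qed

lemma card_basis_restriction:
  assumes "matroid M" "finite X" "basis (restriction M X) B"
  shows "card B = rank M X"
proof -
  have B: "indep M B" "B \<subseteq> X" "\<And>B'. indep M B' \<Longrightarrow> B' \<subseteq> X \<Longrightarrow> B \<subseteq> B' \<Longrightarrow> B' = B"
    using assms(3) unfolding basis_def restriction_def by auto
  obtain J where J: "J \<subseteq> X" "indep M J" "card J = rank M X"
    using rank_attained[of X M] matroid_empty[OF assms(1)] assms(2) by auto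
  have "\<not> card B < card J"
  proof
    assume "card B < card J"
    then obtain e where "e \<in> J - B" "indep M (insert e B)"
      using matroid_augment[OF assms(1) B(1) J(2)] by blast
    then show False using B(2) B(3)[of "insert e B"] J(1) by blast
  qed
  then show ?thesis using rank_ge[OF assms(2) B(2,1)] J(3) by linarith
qed

text \<open>Every notion in \<open>fundamental_flat\<close> is built from the ground set and
  independence, so it is invariant under isomorphism. For an involution, images and preimages
  coincide, which lets one map serve both directions. The lemma carries results about initial
  segments over to final ones.\<close>

lemma fundamental_flat_involution:
  assumes f: "\<And>x. f (f x) = x"
    and ground: "ground M' = f ` ground M"
    and indep: "\<And>I. indep M' I \<longleftrightarrow> indep M (f ` I)"
  shows "fundamental_flat M' X \<longleftrightarrow> fundamental_flat M (f ` X)"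
proof -
  have inj: "inj f" using f by (metis injI)
  have ff [simp]: "f ` f ` Y = Y" for Y by (simp add: image_image f)
  have sub: "f ` Y \<subseteq> Z \<longleftrightarrow> Y \<subseteq> f ` Z" for Y Z by (metis ff image_mono)
  have psub: "f ` Y \<subset> Z \<longleftrightarrow> Y \<subset> f ` Z" for Y Z using sub ff by (metis psubset_eq)
  have mem: "x \<in> f ` Y \<longleftrightarrow> f x \<in> Y" for x Y using f by (metis image_iff)
  have card_f [simp]: "card (f ` Y) = card Y" for Y
    using inj by (simp add: card_image inj_on_subset)
  \<comment> \<open>Taking images permutes the sets, so a quantifier over sets may be replaced by
    one over their images.\<close>
  have all: "(\<forall>Y. R (f ` Y)) \<longleftrightarrow> (\<forall>Y. R Y)" for R
  proof
    assume "\<forall>Y. R (f ` Y)"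
    then show "\<forall>Y. R Y" using ff by (intro allI) (erule allE, erule subst[rotated], rule ff)
  qed blast
  have ex: "(\<exists>Y. R (f ` Y)) \<longleftrightarrow> (\<exists>Y. R Y)" for R
    using all[of "\<lambda>Y. \<not> R Y"] by blast
  have Int: "f ` (Y \<inter> Z) = f ` Y \<inter> f ` Z" for Y Z using inj by (rule image_Int)
  have rank: "rank M' Y = rank M (f ` Y)" for Y
  proof -
    have "card ` {I. I \<subseteq> Y \<and> indep M (f ` I)} = card ` {I. I \<subseteq> f ` Y \<and> indep M I}"
    proof (intro equalityI subsetI)
      fix k assume "k \<in> card ` {I. I \<subseteq> Y \<and> indep M (f ` I)}"
      then obtain I where "I \<subseteq> Y" "indep M (f ` I)" "k = card (f ` I)" by auto
      then show "k \<in> card ` {I. I \<subseteq> f ` Y \<and> indep M I}" by blast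
    next
      fix k assume "k \<in> card ` {I. I \<subseteq> f ` Y \<and> indep M I}"
      then obtain I where "f ` I \<subseteq> Y" "indep M (f ` f ` I)" "k = card (f ` I)"
        using sub by auto
      then show "k \<in> card ` {I. I \<subseteq> Y \<and> indep M (f ` I)}" by blast
    qed
    then show ?thesis unfolding rank_def indep by simp
  qed
  have flat: "flat M' Y \<longleftrightarrow> flat M (f ` Y)" for Y
  proof -
    have "x \<in> f ` ground M - Y \<longleftrightarrow> f x \<in> ground M - f ` Y" for x by (simp add: mem f)
    then have "(\<forall>x \<in> f ` ground M - Y. rank M (f ` Y) < rank M (insert (f x) (f ` Y))) \<longleftrightarrow>
        (\<forall>x \<in> ground M - f ` Y. rank M (f ` Y) < rank M (insert x (f ` Y)))"
      using f by metis
    then show ?thesis unfolding flat_def ground rank by (simp add: sub)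
  qed
  have circuit: "circuit M' C \<longleftrightarrow> circuit M (f ` C)" for C
  proof -
    have "(\<forall>D. D \<subset> C \<longrightarrow> indep M (f ` D)) \<longleftrightarrow> (\<forall>D. D \<subset> f ` C \<longrightarrow> indep M D)"
      using all[of "\<lambda>D. D \<subset> f ` C \<longrightarrow> indep M D"] by (simp add: psub)
    then show ?thesis unfolding circuit_def ground indep by (simp add: sub)
  qed
  have circuit_res: "circuit (restriction M' Y) C \<longleftrightarrow> circuit (restriction M (f ` Y)) (f ` C)"
    for Y C unfolding circuit_restriction_iff circuit by (simp add: sub)
  have conn: "connected_matroid (restriction M' Y) \<longleftrightarrow> connected_matroid (restriction M (f ` Y))"
    for Y
  proof -
    have g: "ground (restriction M' Y) = f ` ground (restriction M (f ` Y))"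
      unfolding restriction_def by (simp add: ground Int)
    have e: "(\<exists>C. circuit (restriction M' Y) C \<and> f x \<in> C \<and> f y \<in> C) \<longleftrightarrow>
        (\<exists>C. circuit (restriction M (f ` Y)) C \<and> x \<in> C \<and> y \<in> C)" for x y
      unfolding circuit_res
      using ex[of "\<lambda>C. circuit (restriction M (f ` Y)) C \<and> x \<in> C \<and> y \<in> C"] by (simp add: mem)
    show ?thesis
      unfolding connected_matroid_def g by (simp add: e inj_eq[OF inj])
  qed
  have span: "spanning M' C \<longleftrightarrow> spanning M (f ` C)" for C
    unfolding spanning_def rank ground by (simp add: sub)
  have bas: "basis (restriction M' Y) B \<longleftrightarrow> basis (restriction M (f ` Y)) (f ` B)" for Y B
  proof -
    have "(\<forall>B'. B' \<subseteq> Y \<and> indep M (f ` B') \<longrightarrow> B \<subseteq> B' \<longrightarrow> B' = B) \<longleftrightarrow>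
      (\<forall>B'. B' \<subseteq> f ` Y \<and> indep M B' \<longrightarrow> f ` B \<subseteq> B' \<longrightarrow> B' = f ` B)"
      using all[of "\<lambda>B'. B' \<subseteq> f ` Y \<and> indep M B' \<longrightarrow> f ` B \<subseteq> B' \<longrightarrow> B' = f ` B"]
      by (simp add: sub inj_image_eq_iff[OF inj])
    then show ?thesis unfolding basis_def restriction_def by (simp add: indep sub)
  qed
  have "(\<exists>C. circuit M (f ` C) \<and> spanning M (f ` C) \<and> basis (restriction M (f ` X)) (f ` (X \<inter> C)))
    \<longleftrightarrow> (\<exists>C. circuit M C \<and> spanning M C \<and> basis (restriction M (f ` X)) (f ` X \<inter> C))"
    using ex[of "\<lambda>C. circuit M C \<and> spanning M C \<and> basis (restriction M (f ` X)) (f ` X \<inter> C)"]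
    by (simp add: Int)
  then show ?thesis
    unfolding fundamental_flat_def flat conn rank circuit span bas ground by simp
qed

section \<open>Matroids of corridors\<close>

text \<open>Here \<open>a\<close> and \<open>b\<close> stand for the heights of the lower and the
  upper border after a given number of steps, and \<open>{s<..t}\<close> holds the steps made
  between times \<open>s\<close> and \<open>t\<close>. The additive form of the bound avoids
  truncated subtraction.\<close>

definition corridor_matroid :: "nat \<Rightarrow> (nat \<Rightarrow> nat) \<Rightarrow> (nat \<Rightarrow> nat) \<Rightarrow> nat indep_system" where
  "corridor_matroid n a b =
     \<lparr>ground = {1..n},
      indep = (\<lambda>I. I \<subseteq> {1..n} \<and> (\<forall>s t. s \<le> t \<longrightarrow> t \<le> n \<longrightarrow> card (I \<inter> {s<..t}) + a s \<le> b t))\<rparr>"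

lemma ground_corridor_matroid [simp]: "ground (corridor_matroid n a b) = {1..n}"
  by (simp add: corridor_matroid_def)

lemma indep_corridor_matroid:
  "indep (corridor_matroid n a b) I \<longleftrightarrow>
     I \<subseteq> {1..n} \<and> (\<forall>s t. s \<le> t \<longrightarrow> t \<le> n \<longrightarrow> card (I \<inter> {s<..t}) + a s \<le> b t)"
  by (simp add: corridor_matroid_def)

lemma indep_corridor_matroid_le:
  "indep (corridor_matroid n a b) I \<Longrightarrow> s \<le> t \<Longrightarrow> t \<le> n \<Longrightarrow> card (I \<inter> {s<..t}) + a s \<le> b t"
  by (simp add: indep_corridor_matroid)

lemma card_Int_split:
  fixes s u t :: nat
  assumes "s \<le> u" "u \<le> t"
  shows "card (I \<inter> {s<..t}) = card (I \<inter> {s<..u}) + card (I \<inter> {u<..t})"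
proof -
  have "I \<inter> {s<..t} = (I \<inter> {s<..u}) \<union> (I \<inter> {u<..t})" using assms by auto
  moreover have "(I \<inter> {s<..u}) \<inter> (I \<inter> {u<..t}) = {}" by auto
  ultimately show ?thesis by (simp add: card_Un_disjoint)
qed

lemma card_Int_mono: "I \<subseteq> J \<Longrightarrow> card (I \<inter> {s<..t::nat}) \<le> card (J \<inter> {s<..t})"
  by (intro card_mono) auto

section \<open>Height functions with unit steps and their rises\<close>

definition unit_steps :: "nat \<Rightarrow> (nat \<Rightarrow> nat) \<Rightarrow> bool" where
  "unit_steps n c \<longleftrightarrow> (\<forall>t<n. c (Suc t) = c t \<or> c (Suc t) = Suc (c t))"

text \<open>If \<open>c\<close> is the height function of a lattice path, these are the positions of
  its North steps, that is, the set selected by the path.\<close>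

definition rises :: "nat \<Rightarrow> (nat \<Rightarrow> nat) \<Rightarrow> nat set" where
  "rises n c = {t \<in> {1..n}. c t \<noteq> c (t - 1)}"

lemma unit_stepsD: "unit_steps n c \<Longrightarrow> t < n \<Longrightarrow> c (Suc t) = c t \<or> c (Suc t) = Suc (c t)"
  by (simp add: unit_steps_def)

lemma unit_steps_mono:
  assumes "unit_steps n c" "s \<le> t" "t \<le> n"
  shows "c s \<le> c t"
  using assms(2,3)
proof (induction t rule: dec_induct)
  case (step t)
  then show ?case using unit_stepsD[OF assms(1), of t] by auto
qed simp

text \<open>If \<open>c t < d t\<close>, then
  \<open>c (Suc t) \<le> Suc (c t) \<le> d t \<le> d (Suc t)\<close>: two such functions cannot
  cross without meeting first.\<close>

lemma unit_steps_max: "unit_steps n c \<Longrightarrow> unit_steps n d \<Longrightarrow> unit_steps n (\<lambda>t. max (c t) (d t))"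
  unfolding unit_steps_def max_def by (smt (verit) le_antisym le_SucI not_less_eq_eq)

lemma unit_steps_min: "unit_steps n c \<Longrightarrow> unit_steps n d \<Longrightarrow> unit_steps n (\<lambda>t. min (c t) (d t))"
  unfolding unit_steps_def min_def by (smt (verit) le_antisym le_SucI not_less_eq_eq)

lemma card_rises:
  assumes "unit_steps n c" "s \<le> t" "t \<le> n"
  shows "card (rises n c \<inter> {s<..t}) + c s = c t"
  using assms(2,3)
proof (induction t rule: dec_induct)
  case (step t)
  have "rises n c \<inter> {s<..Suc t} =
      (if c (Suc t) = c t then rises n c \<inter> {s<..t} else insert (Suc t) (rises n c \<inter> {s<..t}))"
    using step by (auto simp: rises_def le_Suc_eq)
  then show ?case using step unit_stepsD[OF assms(1), of t] by auto
qed simp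

section \<open>Independence, rank and connectedness in a corridor\<close>

locale corridor =
  fixes n r :: nat and a b :: "nat \<Rightarrow> nat"
  assumes steps_a: "unit_steps n a" and steps_b: "unit_steps n b"
    and a0: "a 0 = 0" and b0: "b 0 = 0" and an: "a n = r" and bn: "b n = r"
    and a_le_b: "t \<le> n \<Longrightarrow> a t \<le> b t"
begin

abbreviation "M \<equiv> corridor_matroid n a b"

lemmas mono_a = unit_steps_mono[OF steps_a]
lemmas mono_b = unit_steps_mono[OF steps_b]

text \<open>The interval condition is Hall's condition for intervals; the transversal sends \<open>x\<close> to the
  least row that is free when the elements are placed greedily from left to right.\<close>

lemma corridor_matroid_eq_transversal:
  "M = transversal_matroid {1..n} {1..r} (\<lambda>i. {x \<in> {1..n}. a (x - 1) < i \<and> i \<le> b x})"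
proof -
  have "(\<forall>s t. s \<le> t \<longrightarrow> t \<le> n \<longrightarrow> card (I \<inter> {s<..t}) + a s \<le> b t) \<longleftrightarrow>
      partial_transversal {1..r} (\<lambda>i. {x \<in> {1..n}. a (x - 1) < i \<and> i \<le> b x}) I"
    (is "?G \<longleftrightarrow> ?T") if I: "I \<subseteq> {1..n}" for I
  proof
    assume G: ?G
    \<comment> \<open>Each start \<open>s < x\<close> gives a lower bound for the row of
      \<open>x\<close>: the elements of \<open>I\<close> in \<open>{s<..x}\<close> take increasing
      rows above \<open>a s\<close>. The greedy row is the largest of these bounds; it is taken over
      a nonempty set because elements of \<open>I\<close> are positive.\<close>
    define \<phi> where "\<phi> x = Max ((\<lambda>s. card (I \<inter> {s<..x}) + a s) ` {..<x})" for x
    have ge: "card (I \<inter> {s<..x}) + a s \<le> \<phi> x" if "s < x" for s x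
      unfolding \<phi>_def using that by (intro Max_ge) auto
    have att: "\<exists>s<x. \<phi> x = card (I \<inter> {s<..x}) + a s" if "0 < x" for x
    proof -
      have "\<phi> x \<in> (\<lambda>s. card (I \<inter> {s<..x}) + a s) ` {..<x}"
        unfolding \<phi>_def using that by (intro Max_in) auto
      then show ?thesis by auto
    qed
    have low: "a (x - 1) < \<phi> x" if "x \<in> I" for x
    proof -
      have "I \<inter> {x - 1<..x} = {x}" using that I by auto
      then show ?thesis using ge[of "x - 1" x] that I by force
    qed
    have up: "\<phi> x \<le> b x" if "x \<in> I" for x
    proof -
      have "0 < x" "x \<le> n" using that I by auto
      then show ?thesis using att[of x] G by (metis less_imp_le)
    qed
    have strict: "\<phi> x < \<phi> y" if "x \<in> I" "y \<in> I" "x < y" for x y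
    proof -
      \<comment> \<open>The start attaining the maximum at \<open>x\<close> also competes at
        \<open>y\<close>, where the window gains at least \<open>y\<close> itself.\<close>
      obtain s where s: "s < x" "\<phi> x = card (I \<inter> {s<..x}) + a s"
        using att[of x] I \<open>x \<in> I\<close> by force
      have "y \<in> I \<inter> {s<..y} - I \<inter> {s<..x}" using that s(1) by auto
      moreover have "I \<inter> {s<..x} \<subseteq> I \<inter> {s<..y}" using that by auto
      ultimately have "I \<inter> {s<..x} \<subset> I \<inter> {s<..y}" by blast
      then have "card (I \<inter> {s<..x}) < card (I \<inter> {s<..y})" by (intro psubset_card_mono) auto
      then show ?thesis using ge[of s y] s that by linarith
    qed
    have "inj_on \<phi> I"
      using strict by (metis (no_types, lifting) inj_onI less_irrefl nat_neq_iff)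
    moreover have "\<phi> ` I \<subseteq> {1..r}"
    proof
      fix v assume "v \<in> \<phi> ` I"
      then obtain x where x: "x \<in> I" "v = \<phi> x" by auto
      then have "b x \<le> r" using mono_b[of x n] bn I by auto
      then show "v \<in> {1..r}" using low[of x] up[of x] x by auto
    qed
    ultimately show ?T unfolding partial_transversal_def using low up I by blast
  next
    assume ?T
    then obtain \<phi> where \<phi>: "inj_on \<phi> I" "\<forall>x \<in> I. a (x - 1) < \<phi> x \<and> \<phi> x \<le> b x"
      unfolding partial_transversal_def by blast
    show ?G
    proof (intro allI impI)
      fix s t :: nat assume st: "s \<le> t" "t \<le> n"
      \<comment> \<open>By monotonicity of both borders, the elements of a window use only rows
        above \<open>a s\<close> and up to \<open>b t\<close>; injectivity then bounds their
        number.\<close>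
      have "\<phi> ` (I \<inter> {s<..t}) \<subseteq> {a s<..b t}"
      proof
        fix v assume "v \<in> \<phi> ` (I \<inter> {s<..t})"
        then obtain x where x: "x \<in> I" "s < x" "x \<le> t" "v = \<phi> x" by auto
        then show "v \<in> {a s<..b t}"
          using \<phi>(2) mono_a[of s "x - 1"] mono_b[of x t] st by fastforce
      qed
      then have "card (\<phi> ` (I \<inter> {s<..t})) \<le> card {a s<..b t}" by (intro card_mono) auto
      then have "card (\<phi> ` (I \<inter> {s<..t})) \<le> b t - a s" by simp
      moreover have "card (\<phi> ` (I \<inter> {s<..t})) = card (I \<inter> {s<..t})"
        using \<phi>(1) by (intro card_image) (auto intro: inj_on_subset)
      moreover have "a s \<le> b t" using mono_a[of s t] a_le_b[of t] st by linarith
      ultimately show "card (I \<inter> {s<..t}) + a s \<le> b t" by linarith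
    qed
  qed
  then show ?thesis
    unfolding corridor_matroid_def transversal_matroid_def by (auto intro!: ext)
qed

lemma matroid_corridor: "matroid M"
  unfolding corridor_matroid_eq_transversal by (simp add: matroid_transversal_matroid)

lemma indep_subset: "indep M J \<Longrightarrow> I \<subseteq> J \<Longrightarrow> indep M I"
  by (rule matroid_subset[OF matroid_corridor])

text \<open>Between times \<open>s\<close> and \<open>t\<close> the path climbs from a height of at
  least \<open>a s\<close> to one of at most \<open>b t\<close>, which bounds its North steps
  there.\<close>

lemma indep_rises:
  assumes "unit_steps n c" "\<And>t. t \<le> n \<Longrightarrow> a t \<le> c t \<and> c t \<le> b t"
  shows "indep M (rises n c)"
  unfolding indep_corridor_matroid
proof (intro conjI allI impI)
  show "rises n c \<subseteq> {1..n}" by (auto simp: rises_def)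
  fix s t :: nat assume "s \<le> t" "t \<le> n"
  then show "card (rises n c \<inter> {s<..t}) + a s \<le> b t"
    using card_rises[OF assms(1), of s t] assms(2)[of s] assms(2)[of t] by linarith
qed

lemma indep_rises_b: "indep M (rises n b)"
  using indep_rises[OF steps_b] a_le_b by blast

lemma Int_left: "I \<subseteq> {1..i} \<Longrightarrow> I \<inter> {0<..i} = I" for I :: "nat set" by auto

lemma card_indep_le:
  assumes "indep M I" "I \<subseteq> {1..i}" "i \<le> n"
  shows "card I \<le> b i"
  using indep_corridor_matroid_le[OF assms(1), of 0 i] assms a0 by (simp add: Int_left)

lemma card_rises_b:
  assumes "i \<le> n"
  shows "card (rises n b \<inter> {1..i}) = b i"
proof -
  have "{1..i} = {0<..i}" by auto
  then show ?thesis using card_rises[OF steps_b, of 0 i] assms b0 by simp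
qed

text \<open>The window from \<open>0\<close> to \<open>i\<close> gives the upper bound, since
  \<open>a 0 = 0\<close>; the North steps of the upper border attain it.\<close>

lemma rank_initial:
  assumes "i \<le> n"
  shows "rank M {1..i} = b i"
  using assms card_rises_b card_indep_le indep_subset[OF indep_rises_b]
  by (intro rank_eqI[of _ "rises n b \<inter> {1..i}"]) auto

lemma matroid_rank_corridor: "matroid_rank M = r"
  using rank_initial[of n] bn by simp

text \<open>A window across the meeting point \<open>t\<close> splits there. When the bounds of the
  two halves are added, \<open>b t\<close> from the left cancels \<open>a t\<close> from the
  right.\<close>

lemma indep_glue:
  assumes "t \<le> n" "a t = b t" "indep M (D \<inter> {1..t})" "indep M (D \<inter> {t<..n})" "D \<subseteq> {1..n}"
  shows "indep M D"
  unfolding indep_corridor_matroid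
proof (intro conjI allI impI)
  fix s u :: nat assume su: "s \<le> u" "u \<le> n"
  have l: "card (D \<inter> {s<..v}) + a s \<le> b v" if "s \<le> v" "v \<le> t" for v
  proof -
    have "D \<inter> {1..t} \<inter> {s<..v} = D \<inter> {s<..v}" using that by auto
    then show ?thesis
      using indep_corridor_matroid_le[OF assms(3), of s v] that assms(1) by simp
  qed
  have rr: "card (D \<inter> {v<..u}) + a v \<le> b u" if "t \<le> v" "v \<le> u" for v
  proof -
    have "D \<inter> {t<..n} \<inter> {v<..u} = D \<inter> {v<..u}" using that su by auto
    then show ?thesis
      using indep_corridor_matroid_le[OF assms(4), of v u] that su by simp
  qed
  show "card (D \<inter> {s<..u}) + a s \<le> b u"
  proof (cases "t \<le> s \<or> u \<le> t")
    case True
    then show ?thesis using l[of u] rr[of s] su by blast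
  next
    case False
    then show ?thesis
      using l[of t] rr[of t] card_Int_split[of s t u D] assms(2) su by simp
  qed
qed (use assms(5) in auto)

text \<open>If the borders met at an inner \<open>t\<close>, a circuit through \<open>t\<close> and
  \<open>Suc t\<close> would be cut into two proper, hence independent, parts, and
  \<open>indep_glue\<close> would make it independent.\<close>

lemma connected_imp_strict:
  assumes "connected_matroid M" "0 < t" "t < n"
  shows "a t < b t"
proof (rule ccontr)
  assume "\<not> a t < b t"
  then have eq: "a t = b t" using a_le_b[of t] assms(3) by simp
  have "\<exists>C. circuit M C \<and> t \<in> C \<and> Suc t \<in> C"
    using assms unfolding connected_matroid_def by simp
  then obtain C where C: "circuit M C" "t \<in> C" "Suc t \<in> C" by blast
  have "Suc t \<notin> C \<inter> {1..t}" "t \<notin> C \<inter> {t<..n}" by auto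
  then have "C \<inter> {1..t} \<subset> C" "C \<inter> {t<..n} \<subset> C" using C(2,3) by blast+
  then have "indep M (C \<inter> {1..t})" "indep M (C \<inter> {t<..n})" "C \<subseteq> {1..n}"
    using C(1) unfolding circuit_def by simp_all
  then have "indep M C"
    using indep_glue[of t C] eq assms(3) by simp
  then show False using C(1) unfolding circuit_def by simp
qed

end

section \<open>Fundamental flats of a corridor\<close>

locale strict_corridor = corridor +
  assumes strict: "0 < t \<Longrightarrow> t < n \<Longrightarrow> a t < b t"
begin

text \<open>The two independent sets are the rises of the lattice paths \<open>c\<close> and \<open>d\<close>, which agree except
  between \<open>x\<close> and \<open>y\<close>, where \<open>c\<close> runs along the lower border and \<open>d\<close> one unit above \<open>c\<close>.\<close>

lemma exchange_exists:
  assumes "1 \<le> x" "x < y" "y \<le> n"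
  obtains B where "indep M B" "x \<notin> B" "y \<in> B" "indep M (insert x (B - {y}))" "card B = r"
proof -
  \<comment> \<open>\<open>c\<close> has to go East at step \<open>x\<close> and North at step
    \<open>y\<close> and follow \<open>a\<close> in between. So if \<open>a\<close> rises at
    \<open>x\<close>, \<open>c\<close> runs one unit above \<open>a\<close> before \<open>x\<close>,
    as far as \<open>b\<close> permits; if \<open>a\<close> is level at \<open>y\<close>,
    \<open>c\<close> does the same from \<open>y\<close> on.\<close>
  define c where "c t =
    (if t < x then (if a x = a (x - 1) then a t else min (b t) (Suc (a t)))
     else if t < y then a t
     else (if a y = a (y - 1) then min (b t) (Suc (a t)) else a t))" for t
  \<comment> \<open>Lifting \<open>c\<close> by one from \<open>x\<close> to \<open>y - 1\<close>
    turns step \<open>x\<close> into North and step \<open>y\<close> into East. Strictness leaves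
    room for this, as all these times are strictly between \<open>0\<close> and
    \<open>n\<close>.\<close>
  define d where "d t = (if x \<le> t \<and> t < y then Suc (c t) else c t)" for t
  obtain x' where x': "x = Suc x'" using assms by (cases x) auto
  obtain y' where y': "y = Suc y'" using assms by (cases y) auto
  have step: "(a (Suc t) = a t \<or> a (Suc t) = Suc (a t)) \<and> (b (Suc t) = b t \<or> b (Suc t) = Suc (b t))"
    if "t < n" for t
    using unit_stepsD[OF steps_a that] unit_stepsD[OF steps_b that] by blast
  have b1: "Suc (a t) \<le> b t" if "0 < t" "t < n" for t using strict[OF that] by simp
  have ab: "a t \<le> b t" if "t \<le> n" for t using a_le_b[OF that] .
  define e where "e t = min (b t) (Suc (a t))" for t
  have e_step: "e (Suc t) = e t \<or> e (Suc t) = Suc (e t)" if "t < n" for t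
    using step[OF that] unfolding e_def by linarith
  have c_left: "c t = (if a x = a x' then a t else e t)" if "t < x" for t
    using that x' by (simp add: c_def e_def)
  have c_mid: "c t = a t" if "x \<le> t" "t < y" for t
    using that by (simp add: c_def)
  have c_right: "c t = (if a y = a y' then e t else a t)" if "y \<le> t" for t
    using that assms(2) y' by (simp add: c_def e_def)
  have cx: "c x' = c x" "c x = a x"
  proof -
    show "c x = a x" using c_mid assms(2) by simp
    moreover have "c x' = a x"
    proof (cases "a x = a x'")
      case False
      then have ax: "a x = Suc (a x')" using step[of x'] assms x' by auto
      \<comment> \<open>If \<open>x\<close> were 1, then \<open>a 1 = 1\<close>, and strictness
        would require \<open>b 1\<close> to be at least 2 after a single step.\<close>
      have "0 < x'"
      proof (rule ccontr)
        assume "\<not> 0 < x'"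
        then have "x = Suc 0" using x' by simp
        then show False using ax b1[of x] step[of 0] assms x' a0 b0 by auto
      qed
      then have "Suc (a x') \<le> b x'" using b1[of x'] assms x' by simp
      then show ?thesis using ax False c_left[of x'] x' by (simp add: e_def)
    next
      case True
      have "x' < x" using x' by simp
      then show ?thesis using c_left[of x'] True by presburger
    qed
    ultimately show "c x' = c x" by simp
  qed
  have cy: "c y = Suc (c y')" "c y' = a y'"
  proof -
    have y'n: "y' < n" "x \<le> y'" using assms y' by simp_all
    then show "c y' = a y'" using c_mid y' by simp
    moreover have "Suc (a y') \<le> b y'" using b1[of y'] assms(1) y'n by simp
    moreover have "b y' \<le> b y" "a y = a y' \<or> a y = Suc (a y')"
      using step[OF y'n(1)] y' by auto
    ultimately show "c y = Suc (c y')" using c_right[of y] by (auto simp: e_def)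
  qed
  have c_steps: "unit_steps n c"
    unfolding unit_steps_def
  proof (intro allI impI)
    fix t assume t: "t < n"
    consider "t < x'" | "t = x'" | "x \<le> t" "t < y'" | "t = y'" | "y \<le> t"
      using x' y' by linarith
    then show "c (Suc t) = c t \<or> c (Suc t) = Suc (c t)"
    proof cases
      case 1 then show ?thesis using c_left[of t] c_left[of "Suc t"] step[OF t] e_step[OF t] x' by simp
    next
      case 2 then show ?thesis using cx x' by simp
    next
      case 3 then show ?thesis using c_mid[of t] c_mid[of "Suc t"] step[OF t] y' by simp
    next
      case 4 then show ?thesis using cy y' by simp
    next
      case 5 then show ?thesis using c_right[of t] c_right[of "Suc t"] step[OF t] e_step[OF t] by simp
    qed
  qed
  have c_bounds: "a t \<le> c t \<and> c t \<le> b t" if "t \<le> n" for t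
  proof -
    have "a t \<le> e t \<and> e t \<le> b t" using ab[OF that] by (simp add: e_def)
    moreover have "c t = a t \<or> c t = e t"
      using c_left[of t] c_mid[of t] c_right[of t] by (metis not_less)
    ultimately show ?thesis using ab[OF that] by auto
  qed
  have d_bounds: "a t \<le> d t \<and> d t \<le> b t" if "t \<le> n" for t
    using c_bounds[OF that] b1[of t] c_mid[of t] assms by (simp add: d_def)
  have d_steps: "unit_steps n d"
    unfolding unit_steps_def
  proof (intro allI impI)
    fix t assume t: "t < n"
    consider "t = x'" | "t = y'" | "t \<noteq> x'" "t \<noteq> y'" by blast
    then show "d (Suc t) = d t \<or> d (Suc t) = Suc (d t)"
    proof cases
      case 1 then show ?thesis using cx x' y' assms by (auto simp: d_def)
    next
      case 2 then show ?thesis using cy x' y' assms by (auto simp: d_def)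
    next
      case 3 then show ?thesis using unit_stepsD[OF c_steps t] x' y' by (auto simp: d_def)
    qed
  qed
  have xB: "x \<notin> rises n c" using cx x' by (simp add: rises_def)
  have yB: "y \<in> rises n c" using cy y' assms by (simp add: rises_def)
  have "rises n d = insert x (rises n c - {y})"
  proof (rule set_eqI)
    fix z
    show "z \<in> rises n d \<longleftrightarrow> z \<in> insert x (rises n c - {y})"
    proof (cases "z = x \<or> z = y")
      case True
      then show ?thesis using cx cy x' y' assms by (auto simp: rises_def d_def)
    next
      case False
      have "z \<in> rises n d \<longleftrightarrow> z \<in> rises n c" if "1 \<le> z"
      proof -
        obtain z' where "z = Suc z'" using \<open>1 \<le> z\<close> by (cases z) auto
        then show ?thesis using False x' y' by (auto simp: rises_def d_def)
      qed
      then show ?thesis using False by (auto simp: rises_def)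
    qed
  qed
  moreover have "card (rises n c) = r"
  proof -
    have "rises n c \<inter> {0<..n} = rises n c" by (auto simp: rises_def)
    then show ?thesis
      using card_rises[OF c_steps, of 0 n] c_bounds[of 0] c_bounds[of n] a0 b0 an bn by simp
  qed
  ultimately show ?thesis
    using that[of "rises n c"] xB yB indep_rises[OF c_steps c_bounds] indep_rises[OF d_steps d_bounds]
    by simp
qed

section \<open>Initial segments at corners of the upper border\<close>

lemma connected_restriction_initial:
  assumes "0 < i" "i < n" "b i = b (i - 1)"
  shows "connected_matroid (restriction M {1..i})"
proof -
  \<comment> \<open>Exchange pairs come from a smaller corridor formed by the paths that reach
    height \<open>b i\<close> after \<open>i\<close> steps. With truncated subtraction,
    \<open>b i + t - i\<close> is the height of the path that goes East until only North steps
    remain; no path reaching \<open>b i\<close> can run below it.\<close>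
  let ?a = "\<lambda>t. max (a t) (b i + t - i)"
  have le: "b i \<le> b t + (i - t)" if "t \<le> i" for t
    using that
  proof (induction t rule: inc_induct)
    case (step t)
    then show ?case using unit_stepsD[OF steps_b, of t] assms by auto
  qed simp
  \<comment> \<open>Step \<open>i\<close> of \<open>b\<close> is East, so from \<open>t\<close> on
    \<open>b\<close> gains at most \<open>i - 1 - t\<close>. This makes the smaller corridor
    strict.\<close>
  have less: "b i < b t + (i - t)" if "t < i" for t
  proof -
    have "b (i - 1) \<le> b t + (i - 1 - t)"
    proof -
      have "b i \<le> b t + (i - 1 - t)" if "t \<le> i - 1" for t
        using that
      proof (induction t rule: inc_induct)
        case (step t)
        then have "b (Suc t) = b t \<or> b (Suc t) = Suc (b t)"
          using unit_stepsD[OF steps_b, of t] assms(2) by linarith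
        then show ?case using step by linarith
      qed (use assms in simp)
      then show ?thesis using that assms(3) by simp
    qed
    then show ?thesis using assms(3) that by linarith
  qed
  interpret sub: strict_corridor i "b i" ?a b
  proof
    have "unit_steps i (\<lambda>t. b i + t - i)" unfolding unit_steps_def by auto
    moreover have "unit_steps i a" using steps_a assms(2) unfolding unit_steps_def by auto
    ultimately show "unit_steps i ?a" by (rule unit_steps_max[rotated])
    show "unit_steps i b" using steps_b assms(2) unfolding unit_steps_def by auto
    show "?a 0 = 0" using le[of 0] a0 b0 by simp
    show "b 0 = 0" "b i = b i" using b0 by simp_all
    show "?a i = b i" using a_le_b[of i] assms by simp
    show "?a t \<le> b t" if "t \<le> i" for t using le[OF that] a_le_b[of t] assms that by simp
    show "?a t < b t" if "0 < t" "t < i" for t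
      using less[of t] strict[of t] assms that by simp
  qed
  \<comment> \<open>Raising the lower border only strengthens the condition, and a window reaching
    past \<open>i\<close> sees no further elements of \<open>I\<close>.\<close>
  have transfer: "indep M I" if "indep sub.M I" for I
    unfolding indep_corridor_matroid
  proof (intro conjI allI impI)
    have I: "I \<subseteq> {1..i}" using that unfolding indep_corridor_matroid by blast
    then show "I \<subseteq> {1..n}" using assms(2) by auto
    fix s t :: nat assume st: "s \<le> t" "t \<le> n"
    have *: "card (I \<inter> {s<..v}) + a s \<le> b v" if "s \<le> v" "v \<le> i" for v
      using indep_corridor_matroid_le[OF \<open>indep sub.M I\<close> that] by simp
    consider "t \<le> i" | "s \<le> i" "i < t" | "i < s" by linarith
    then show "card (I \<inter> {s<..t}) + a s \<le> b t"
    proof cases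
      case 1 then show ?thesis using * st by blast
    next
      case 2
      then have "I \<inter> {s<..t} = I \<inter> {s<..i}" using I by auto
      then show ?thesis using *[of i] 2 mono_b[of i t] st by simp
    next
      case 3
      then have "I \<inter> {s<..t} = {}" using I by auto
      then show ?thesis using mono_a[of s t] a_le_b[of t] st by simp
    qed
  qed
  have main: "\<exists>C. circuit (restriction M {1..i}) C \<and> x \<in> C \<and> y \<in> C"
    if xy: "1 \<le> x" "x < y" "y \<le> i" for x y
  proof -
    obtain B where B: "indep sub.M B" "x \<notin> B" "indep sub.M (insert x (B - {y}))" "card B = b i"
      by (rule sub.exchange_exists[OF xy])
    have sub: "insert x B \<subseteq> {1..i}"
      using B(1) xy unfolding indep_corridor_matroid by auto
    then have "finite B" by (auto intro: finite_subset)
    \<comment> \<open>\<open>B\<close> already has \<open>b i\<close> elements, the rank of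
      \<open>{1..i}\<close> in the large matroid.\<close>
    then have "\<not> indep M (insert x B)"
      using card_indep_le[OF _ sub] B(2,4) assms(2) by force
    then obtain C where "circuit M C" "x \<in> C" "y \<in> C" "C \<subseteq> insert x B"
      by (rule circuit_through_exchange[OF matroid_corridor transfer[OF B(1)] transfer[OF B(3)]])
    then show ?thesis using sub unfolding circuit_restriction_iff by blast
  qed
  show ?thesis
    unfolding connected_matroid_def
  proof (intro ballI impI)
    fix x y assume "x \<in> ground (restriction M {1..i})" "y \<in> ground (restriction M {1..i})" "x \<noteq> y"
    then have "1 \<le> x" "1 \<le> y" "x \<le> i" "y \<le> i" "x < y \<or> y < x"
      by (auto simp: restriction_def)
    then show "\<exists>C. circuit (restriction M {1..i}) C \<and> x \<in> C \<and> y \<in> C"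
      using main[of x y] main[of y x] by blast
  qed
qed

text \<open>The North steps of \<open>b\<close> up to \<open>i\<close> stay independent when any
  later \<open>x\<close> is added. A window starting at or before \<open>i\<close> has room for
  \<open>x\<close> because \<open>b\<close> rises at \<open>Suc i\<close>; a window starting later
  contains \<open>x\<close> alone, and strictness suffices.\<close>

lemma flat_initial:
  assumes "0 < i" "i < n" "b (Suc i) = Suc (b i)"
  shows "flat M {1..i}"
  unfolding flat_def
proof (intro conjI ballI)
  show "{1..i} \<subseteq> ground M" using assms(2) by simp
  fix x assume "x \<in> ground M - {1..i}"
  then have x: "i < x" "x \<le> n" by auto
  let ?B = "rises n b \<inter> {1..i}"
  have "indep M (insert x ?B)"
    unfolding indep_corridor_matroid
  proof (intro conjI allI impI)
    show "insert x ?B \<subseteq> {1..n}" using x assms(2) by auto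
    fix s t :: nat assume st: "s \<le> t" "t \<le> n"
    show "card (insert x ?B \<inter> {s<..t}) + a s \<le> b t"
    proof (cases "x \<in> {s<..t}")
      case False
      then have "insert x ?B \<inter> {s<..t} = ?B \<inter> {s<..t}" by auto
      then show ?thesis
        using indep_corridor_matroid_le[OF indep_subset[OF indep_rises_b] st] by simp
    next
      case True
      show ?thesis
      proof (cases "s \<le> i")
        case True
        have "insert x ?B \<inter> {s<..t} \<subseteq> insert x (rises n b \<inter> {s<..i})" by auto
        then have "card (insert x ?B \<inter> {s<..t}) \<le> Suc (card (rises n b \<inter> {s<..i}))"
          using card_mono[of "insert x (rises n b \<inter> {s<..i})" "insert x ?B \<inter> {s<..t}"]
          by (simp add: card_insert_if split: if_splits)
        moreover have "card (rises n b \<inter> {s<..i}) + b s = b i"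
          using card_rises[OF steps_b, of s i] True assms(2) by simp
        moreover have "a s \<le> b s" using a_le_b[of s] st by simp
        moreover have "b (Suc i) \<le> b t"
          using mono_b[of "Suc i" t] st x \<open>x \<in> {s<..t}\<close> by simp
        ultimately show ?thesis using assms(3) by linarith
      next
        case False
        then have "insert x ?B \<inter> {s<..t} = {x}" using True by auto
        moreover have "a s < b s" "b s \<le> b t"
          using strict[of s] mono_b[of s t] st True False x by auto
        ultimately show ?thesis by simp
      qed
    qed
  qed
  moreover have "insert x ?B \<subseteq> insert x {1..i}" by auto
  ultimately have "card (insert x ?B) \<le> rank M (insert x {1..i})"
    by (intro rank_ge) auto
  moreover have "card (insert x ?B) = Suc (b i)"
    using card_rises_b[of i] x assms(2) by simp
  ultimately show "rank M {1..i} < rank M (insert x {1..i})"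
    using rank_initial[of i] assms(2) by simp
qed

text \<open>The set has \<open>Suc r\<close> elements, so it is dependent. After deletion of a North
  step \<open>z\<close>, the element \<open>n\<close> takes the place of \<open>z\<close> in windows
  containing both; a window with \<open>n\<close> but without \<open>z\<close> starts at a positive
  time, where strictness leaves room for one more element.\<close>

lemma spanning_circuit_rises_b:
  assumes "2 \<le> n"
  shows "circuit M (insert n (rises n b))" "spanning M (insert n (rises n b))"
proof -
  let ?R = "rises n b" and ?C = "insert n (rises n b)"
  have finR: "finite ?R" by (simp add: rises_def)
  have cardR: "card ?R = r"
  proof -
    have "?R \<inter> {1..n} = ?R" by (auto simp: rises_def)
    then show ?thesis using card_rises_b[of n] bn by simp
  qed
  \<comment> \<open>\<open>a\<close> gains at most one in its last step, so \<open>a (n - 1)\<close>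
    is at least \<open>r - 1\<close>, and \<open>b (n - 1)\<close> is larger. Hence \<open>n\<close>
    is no North step of \<open>b\<close>.\<close>
  have bn1: "b (n - 1) = r"
  proof -
    have "a (n - 1) < b (n - 1)" using strict[of "n - 1"] assms by simp
    moreover have "r \<le> Suc (a (n - 1))"
      using unit_stepsD[OF steps_a, of "n - 1"] assms an by auto
    moreover have "b (n - 1) \<le> r" using mono_b[of "n - 1" n] bn by simp
    ultimately show ?thesis by linarith
  qed
  then have nR: "n \<notin> ?R" using bn by (simp add: rises_def)
  have C_sub: "?C \<subseteq> {1..n}" using assms by (auto simp: rises_def)
  have dep: "\<not> indep M ?C"
    using card_indep_le[OF _ C_sub] nR finR cardR bn by force
  have del: "indep M (?C - {z})" if "z \<in> ?C" for z
    unfolding indep_corridor_matroid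
  proof (intro conjI allI impI)
    show "?C - {z} \<subseteq> {1..n}" using C_sub by auto
    fix s t :: nat assume st: "s \<le> t" "t \<le> n"
    have R: "card (?R \<inter> {s<..t}) + b s = b t" using card_rises[OF steps_b st] .
    have abs: "a s \<le> b s" using a_le_b[of s] st by simp
    show "card ((?C - {z}) \<inter> {s<..t}) + a s \<le> b t"
    proof (cases "n \<in> {s<..t} \<and> z \<noteq> n")
      case False
      then have "(?C - {z}) \<inter> {s<..t} \<subseteq> ?R \<inter> {s<..t}" by auto
      then have "card ((?C - {z}) \<inter> {s<..t}) \<le> card (?R \<inter> {s<..t})" by (intro card_mono) auto
      then show ?thesis using R abs by linarith
    next
      case True
      then have t: "t = n" "s < n" using st by auto
      have zR: "z \<in> ?R" using that True by simp
      show ?thesis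
      proof (cases "z \<in> {s<..t}")
        case z: True
        have eq: "(?C - {z}) \<inter> {s<..t} = insert n (?R \<inter> {s<..t} - {z})" using True by auto
        have "card (insert n (?R \<inter> {s<..t} - {z})) = Suc (card (?R \<inter> {s<..t} - {z}))"
          using nR by simp
        also have "\<dots> = card (?R \<inter> {s<..t})"
          using z zR finR by (intro card.remove[symmetric]) auto
        finally show ?thesis using eq R abs by simp
      next
        case z: False
        then have "0 < s" using zR t by (auto simp: rises_def)
        then have "a s < b s" using strict t by simp
        moreover have "(?C - {z}) \<inter> {s<..t} = insert n (?R \<inter> {s<..t})" using True z by auto
        then have "card ((?C - {z}) \<inter> {s<..t}) = Suc (card (?R \<inter> {s<..t}))" using nR by simp
        ultimately show ?thesis using R by linarith
      qed
    qed
  qed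
  show "circuit M ?C"
    unfolding circuit_def
  proof (intro conjI allI impI)
    fix D assume "D \<subset> ?C"
    then obtain z where "z \<in> ?C" "D \<subseteq> ?C - {z}" by blast
    then show "indep M D" using indep_subset[OF del] by blast
  qed (use C_sub dep in auto)
  have "rank M ?C = r"
  proof (rule rank_eqI)
    show "finite ?C" "?R \<subseteq> ?C" using finR by auto
    show "indep M ?R" "card ?R = r" using indep_rises_b cardR by auto
    show "card J \<le> r" if "J \<subseteq> ?C" "indep M J" for J
      using card_indep_le[OF that(2) subset_trans[OF that(1) C_sub]] bn by simp
  qed
  then show "spanning M ?C" using C_sub matroid_rank_corridor unfolding spanning_def by simp
qed

text \<open>The East step at \<open>i\<close> gives connectedness and the North step after it gives
  flatness. One circuit serves every \<open>i\<close>: it meets \<open>{1..i}\<close> in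
  \<open>b i\<close> North steps of \<open>b\<close>, as many as the rank.\<close>

lemma fundamental_flat_initial:
  assumes "0 < i" "i < n" "b i = b (i - 1)" "b (Suc i) = Suc (b i)"
  shows "fundamental_flat M {1..i}"
proof -
  \<comment> \<open>A border \<open>b\<close> starting with an East step would contradict
    \<open>a 1 < b 1\<close>. This gives the flat more than one element.\<close>
  have "i \<noteq> 1"
    using strict[of 1] assms b0 by auto
  let ?C = "insert n (rises n b)"
  have eq: "{1..i} \<inter> ?C = rises n b \<inter> {1..i}" using assms(2) by auto
  have card: "card (rises n b \<inter> {1..i}) = b i" using card_rises_b[of i] assms(2) by simp
  have "basis (restriction M {1..i}) ({1..i} \<inter> ?C)"
    unfolding basis_def eq
  proof (intro conjI allI impI)
    show "indep (restriction M {1..i}) (rises n b \<inter> {1..i})"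
      using indep_subset[OF indep_rises_b] by (simp add: restriction_def)
    fix B' assume B': "indep (restriction M {1..i}) B'" "rises n b \<inter> {1..i} \<subseteq> B'"
    then have "B' \<subseteq> {1..i}" "indep M B'" by (simp_all add: restriction_def)
    then have "finite B'" "card B' \<le> b i"
      using card_indep_le[of B' i] assms(2) by (auto intro: finite_subset)
    then show "B' = rises n b \<inter> {1..i}"
      using B'(2) card by (metis card_seteq)
  qed
  moreover have "rank M {1..i} < matroid_rank M"
    using rank_initial[of i] matroid_rank_corridor mono_b[of "Suc i" n] assms(2,4) bn by simp
  ultimately show ?thesis
    unfolding fundamental_flat_def
    using flat_initial[OF assms(1,2,4)] connected_restriction_initial[OF assms(1,2,3)]
      spanning_circuit_rises_b \<open>i \<noteq> 1\<close> assms(1,2)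
    by auto
qed

end

section \<open>The half turn and final segments\<close>

definition mirror :: "nat \<Rightarrow> nat \<Rightarrow> nat" where
  "mirror n x = (if x \<in> {1..n} then Suc n - x else x)"

lemma mirror_mirror: "mirror n (mirror n x) = x"
  by (auto simp: mirror_def)

lemma inj_mirror: "inj (mirror n)"
  by (metis injI mirror_mirror)

lemma mem_mirror_image: "x \<in> mirror n ` Y \<longleftrightarrow> mirror n x \<in> Y"
  by (metis image_iff mirror_mirror)

lemma mirror_image_interval:
  assumes "t \<le> n"
  shows "mirror n ` {s<..t} = {n - t<..n - s}"
proof (rule set_eqI)
  fix x
  show "x \<in> mirror n ` {s<..t} \<longleftrightarrow> x \<in> {n - t<..n - s}"
    using assms unfolding mem_mirror_image by (auto simp: mirror_def)
qed

lemma card_mirror_image_Int: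
  assumes "s \<le> t" "t \<le> n"
  shows "card (mirror n ` I \<inter> {s<..t}) = card (I \<inter> {n - t<..n - s})"
proof -
  have "mirror n ` {n - t<..n - s} = {s<..t}"
    using assms by (subst mirror_image_interval) auto
  then have "mirror n ` I \<inter> {s<..t} = mirror n ` (I \<inter> {n - t<..n - s})"
    by (simp add: image_Int inj_mirror)
  then show ?thesis
    using card_image[OF inj_on_subset[OF inj_mirror subset_UNIV]] by simp
qed

context strict_corridor
begin

text \<open>A half turn reads the paths backwards from their endpoint: the height \<open>c t\<close>
  becomes \<open>r - c (n - t)\<close>, and the two borders change roles.\<close>

lemma strict_corridor_mirror:
  "strict_corridor n r (\<lambda>t. r - b (n - t)) (\<lambda>t. r - a (n - t))"
proof
  have r: "a t \<le> r" "b t \<le> r" if "t \<le> n" for t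
    using mono_a[of t n] mono_b[of t n] an bn that by simp_all
  have step: "\<exists>s<n. n - t = Suc s \<and> n - Suc t = s" if "t < n" for t
    using that by (intro exI[of _ "n - Suc t"]) auto
  show "unit_steps n (\<lambda>t. r - b (n - t))"
    unfolding unit_steps_def
  proof (intro allI impI)
    fix t assume "t < n"
    then obtain s where s: "s < n" "n - t = Suc s" "n - Suc t = s" using step by blast
    then show "r - b (n - Suc t) = r - b (n - t) \<or> r - b (n - Suc t) = Suc (r - b (n - t))"
      using unit_stepsD[OF steps_b s(1)] r(2)[of "Suc s"] by auto
  qed
  show "unit_steps n (\<lambda>t. r - a (n - t))"
    unfolding unit_steps_def
  proof (intro allI impI)
    fix t assume "t < n"
    then obtain s where s: "s < n" "n - t = Suc s" "n - Suc t = s" using step by blast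
    then show "r - a (n - Suc t) = r - a (n - t) \<or> r - a (n - Suc t) = Suc (r - a (n - t))"
      using unit_stepsD[OF steps_a s(1)] r(1)[of "Suc s"] by auto
  qed
  show "r - b (n - t) \<le> r - a (n - t)" for t
    using a_le_b[of "n - t"] by simp
  show "r - b (n - t) < r - a (n - t)" if "0 < t" "t < n" for t
    using strict[of "n - t"] r(2)[of "n - t"] that by simp
qed (use a0 b0 an bn in simp_all)

text \<open>The window \<open>{s<..t}\<close> corresponds to \<open>{n - t<..n - s}\<close>, and
  complementing both bounds in \<open>r\<close> yields the same inequality. The subtractions are
  exact because heights never exceed \<open>r\<close>.\<close>

lemma indep_mirror:
  "indep (corridor_matroid n (\<lambda>t. r - b (n - t)) (\<lambda>t. r - a (n - t))) I \<longleftrightarrow>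
    indep M (mirror n ` I)"
proof -
  have r: "a t \<le> r" "b t \<le> r" if "t \<le> n" for t
    using mono_a[of t n] mono_b[of t n] an bn that by simp_all
  have "mirror n ` {1..n} = {1..n}"
    using mirror_image_interval[of n n 0] by (simp add: atLeastSucAtMost_greaterThanAtMost)
  then have sub: "mirror n ` I \<subseteq> {1..n} \<longleftrightarrow> I \<subseteq> {1..n}"
    by (metis inj_mirror inj_image_subset_iff)
  have "(\<forall>s t. s \<le> t \<longrightarrow> t \<le> n \<longrightarrow> card (I \<inter> {s<..t}) + (r - b (n - s)) \<le> r - a (n - t)) \<longleftrightarrow>
    (\<forall>s t. s \<le> t \<longrightarrow> t \<le> n \<longrightarrow> card (mirror n ` I \<inter> {s<..t}) + a s \<le> b t)" (is "?L \<longleftrightarrow> ?R")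
  proof
    assume L: ?L
    show ?R
    proof (intro allI impI)
      fix s t assume st: "s \<le> t" "t \<le> n"
      have "card (I \<inter> {n - t<..n - s}) + (r - b (n - (n - t))) \<le> r - a (n - (n - s))"
        using L[rule_format, of "n - t" "n - s"] st by simp
      then show "card (mirror n ` I \<inter> {s<..t}) + a s \<le> b t"
        using card_mirror_image_Int[OF st, of I] r[of t] r[of s] st by simp
    qed
  next
    assume R: ?R
    show ?L
    proof (intro allI impI)
      fix s t assume st: "s \<le> t" "t \<le> n"
      have "card (mirror n ` I \<inter> {n - t<..n - s}) + a (n - t) \<le> b (n - s)"
        using R[rule_format, of "n - t" "n - s"] st by simp
      moreover have "card (mirror n ` I \<inter> {n - t<..n - s}) = card (I \<inter> {s<..t})"
        using card_mirror_image_Int[of "n - t" "n - s" n I] st by simp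
      ultimately show "card (I \<inter> {s<..t}) + (r - b (n - s)) \<le> r - a (n - t)"
        using r(2)[of "n - s"] by simp
    qed
  qed
  then show ?thesis unfolding indep_corridor_matroid sub by simp
qed

text \<open>\<open>mirror\<close> fixes all numbers outside \<open>{1..n}\<close>, so it is an
  involution of all natural numbers, as the transport lemma requires.\<close>

lemma fundamental_flat_mirror:
  "fundamental_flat (corridor_matroid n (\<lambda>t. r - b (n - t)) (\<lambda>t. r - a (n - t))) X \<longleftrightarrow>
    fundamental_flat M (mirror n ` X)"
proof (rule fundamental_flat_involution[OF mirror_mirror _ indep_mirror])
  show "ground (corridor_matroid n (\<lambda>t. r - b (n - t)) (\<lambda>t. r - a (n - t))) = mirror n ` ground M"
    using mirror_image_interval[of n n 0] by (simp add: atLeastSucAtMost_greaterThanAtMost)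
qed

lemma fundamental_flat_final_iff_initial:
  assumes "j \<le> n"
  shows "fundamental_flat M {j<..n} \<longleftrightarrow>
    fundamental_flat (corridor_matroid n (\<lambda>t. r - b (n - t)) (\<lambda>t. r - a (n - t))) {1..n - j}"
proof -
  have "mirror n ` {0<..n - j} = {j<..n}"
    using assms by (subst mirror_image_interval) auto
  moreover have "{0<..n - j} = {1..n - j}" by auto
  ultimately show ?thesis by (simp add: fundamental_flat_mirror)
qed

text \<open>Under the half turn, a North step of \<open>a\<close> at \<open>j\<close> followed by an
  East step becomes an East step of the new upper border at \<open>n - j\<close> followed by a North
  step.\<close>

lemma fundamental_flat_final:
  assumes "0 < j" "j < n" "a j = Suc (a (j - 1))" "a (Suc j) = a j"
  shows "fundamental_flat M {j<..n}"
proof -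
  interpret mirror: strict_corridor n r "\<lambda>t. r - b (n - t)" "\<lambda>t. r - a (n - t)"
    by (rule strict_corridor_mirror)
  have "a j \<le> r" using mono_a[of j n] an assms by simp
  moreover have "n - (n - j - 1) = Suc j" "n - Suc (n - j) = j - 1" "n - (n - j) = j"
    using assms by auto
  ultimately have "fundamental_flat mirror.M {1..n - j}"
    using assms by (intro mirror.fundamental_flat_initial) auto
  then show ?thesis using fundamental_flat_final_iff_initial[of j] assms by simp
qed

text \<open>Flatness makes the rank grow when \<open>Suc i\<close> is added, so \<open>b\<close>
  rises there. If \<open>b\<close> also rose at \<open>i\<close>, then \<open>i\<close> would be a
  coloop of the restriction: windows containing \<open>i\<close> would gain room for it, so no
  circuit in \<open>{1..i}\<close> could pass through \<open>i\<close>.\<close>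

lemma fundamental_flat_initialD:
  assumes "fundamental_flat M {1..i}"
  shows "0 < i" "i < n" "b i = b (i - 1)" "b (Suc i) = Suc (b i)"
proof -
  have flat: "flat M {1..i}" and conn: "connected_matroid (restriction M {1..i})"
    and "card {1..i} > 1" and rank: "rank M {1..i} < matroid_rank M"
    using assms unfolding fundamental_flat_def by blast+
  then have i: "1 < i" by simp
  then show "0 < i" by simp
  have "i \<le> n" using flat i unfolding flat_def by auto
  moreover have "i \<noteq> n" using rank by auto
  ultimately show n: "i < n" by simp
  have "rank M {1..i} < rank M (insert (Suc i) {1..i})"
    using flat n unfolding flat_def by auto
  moreover have "insert (Suc i) {1..i} = {1..Suc i}" by auto
  ultimately have "b i < b (Suc i)" using rank_initial[of i] rank_initial[of "Suc i"] n by simp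
  then show "b (Suc i) = Suc (b i)" using unit_stepsD[OF steps_b n] by auto
  show "b i = b (i - 1)"
  proof (rule ccontr)
    assume "b i \<noteq> b (i - 1)"
    then have bi: "b i = Suc (b (i - 1))" using unit_stepsD[OF steps_b, of "i - 1"] i n by auto
    have "1 \<in> ground (restriction M {1..i})" "i \<in> ground (restriction M {1..i})"
      using i n by (simp_all add: restriction_def)
    then obtain C where "circuit (restriction M {1..i}) C" "i \<in> C"
      using conn i unfolding connected_matroid_def by (metis less_irrefl)
    then have C: "circuit M C" "C \<subseteq> {1..i}" unfolding circuit_restriction_iff by blast+
    have "C - {i} \<subset> C" using \<open>i \<in> C\<close> by blast
    then have del: "indep M (C - {i})" using C(1) unfolding circuit_def by simp
    have "indep M C"
      unfolding indep_corridor_matroid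
    proof (intro conjI allI impI)
      show "C \<subseteq> {1..n}" using C(2) n by auto
      fix s t :: nat assume st: "s \<le> t" "t \<le> n"
      show "card (C \<inter> {s<..t}) + a s \<le> b t"
      proof (cases "i \<in> {s<..t}")
        case False
        then have "C \<inter> {s<..t} = (C - {i}) \<inter> {s<..t}" by auto
        then show ?thesis using indep_corridor_matroid_le[OF del st] by simp
      next
        case True
        then have "C \<inter> {s<..t} = insert i ((C - {i}) \<inter> {s<..i - 1})"
          using C(2) \<open>i \<in> C\<close> i by auto
        then have "card (C \<inter> {s<..t}) = Suc (card ((C - {i}) \<inter> {s<..i - 1}))" by simp
        moreover have "card ((C - {i}) \<inter> {s<..i - 1}) + a s \<le> b (i - 1)"
          using indep_corridor_matroid_le[OF del, of s "i - 1"] True n by force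
        moreover have "b i \<le> b t" using mono_b[of i t] True st by simp
        ultimately show ?thesis using bi by simp
      qed
    qed
    then show False using C(1) unfolding circuit_def by simp
  qed
qed

lemma fundamental_flat_finalD:
  assumes "fundamental_flat M {j<..n}" "j \<le> n"
  shows "0 < j" "j < n" "a j = Suc (a (j - 1))" "a (Suc j) = a j"
proof -
  interpret mirror: strict_corridor n r "\<lambda>t. r - b (n - t)" "\<lambda>t. r - a (n - t)"
    by (rule strict_corridor_mirror)
  have "fundamental_flat mirror.M {1..n - j}"
    using assms fundamental_flat_final_iff_initial by blast
  note D = mirror.fundamental_flat_initialD[OF this]
  then show j: "0 < j" "j < n" by simp_all
  have "a (Suc j) \<le> r" "a j \<le> r" "a (j - 1) \<le> r"
    using mono_a[of _ n] an j by simp_all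
  moreover have "n - (n - j - 1) = Suc j" "n - Suc (n - j) = j - 1" "n - (n - j) = j"
    using j by linarith+
  ultimately have "r - a j = r - a (Suc j)" "r - a (j - 1) = Suc (r - a j)"
    using D(3,4) by simp_all
  with \<open>a (Suc j) \<le> r\<close> \<open>a j \<le> r\<close> \<open>a (j - 1) \<le> r\<close>
  show "a j = Suc (a (j - 1))" "a (Suc j) = a j" by linarith+
qed

section \<open>Spanning circuits and the shape of fundamental flats\<close>

lemma card_spanning_circuit:
  assumes "circuit M C" "spanning M C"
  shows "card C = Suc r"
proof -
  have C: "C \<subseteq> {1..n}" "\<not> indep M C" "\<And>D. D \<subset> C \<Longrightarrow> indep M D"
    using assms(1) unfolding circuit_def by simp_all
  have fin: "finite C" using C(1) by (auto intro: finite_subset)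
  have rank: "rank M C = r" using assms(2) matroid_rank_corridor unfolding spanning_def by simp
  obtain I where I: "I \<subseteq> C" "indep M I" "card I = r"
    using rank_attained[OF fin matroid_empty[OF matroid_corridor]] rank by metis
  then have "I \<subset> C" using C(2) by blast
  then have "r < card C" using psubset_card_mono[OF fin] I(3) by metis
  obtain z where "z \<in> C" using \<open>I \<subset> C\<close> by blast
  then have "card (C - {z}) \<le> r"
    using card_indep_le[OF C(3), of "C - {z}" n] C(1) bn by force
  then show ?thesis using \<open>r < card C\<close> \<open>z \<in> C\<close> fin by simp
qed

text \<open>Counting in \<open>C\<close> without its last, respectively its first, element.\<close>

lemma card_circuit_initial_le:
  assumes "circuit M C" "C \<inter> {t<..n} \<noteq> {}" "t \<le> n"
  shows "card (C \<inter> {0<..t}) \<le> b t"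
proof -
  obtain z where z: "z \<in> C" "t < z" using assms(2) by auto
  then have "indep M (C - {z})" using assms(1) unfolding circuit_def by auto
  moreover have "(C - {z}) \<inter> {0<..t} = C \<inter> {0<..t}" using z by auto
  ultimately show ?thesis using indep_corridor_matroid_le[of n a b _ 0 t] a0 assms(3) by force
qed

lemma card_circuit_final_le:
  assumes "circuit M C" "C \<inter> {0<..s} \<noteq> {}" "s \<le> n"
  shows "card (C \<inter> {s<..n}) + a s \<le> r"
proof -
  obtain z where z: "z \<in> C" "z \<le> s" using assms(2) by auto
  then have "indep M (C - {z})" using assms(1) unfolding circuit_def by auto
  moreover have "(C - {z}) \<inter> {s<..n} = C \<inter> {s<..n}" using z by auto
  ultimately show ?thesis using indep_corridor_matroid_le[of n a b _ s n] bn assms(3) by force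
qed

text \<open>Each element of \<open>X\<close> outside \<open>B\<close> lies in a window that
  \<open>B\<close> fills completely, and counting in \<open>C\<close> lets this window be stretched
  to the start or to the end. The largest full initial window and the smallest full final one then
  contain all of \<open>X\<close> except elements of \<open>B\<close>, and connectedness leaves only
  one of them.\<close>

lemma fundamental_flat_interval:
  assumes "fundamental_flat M X"
  obtains t where "t \<le> n" "X = {1..t} \<or> X = {t<..n}"
proof -
  have flat: "flat M X" and conn: "connected_matroid (restriction M X)"
    and card_X: "card X > 1" and rank: "rank M X < r"
    using assms matroid_rank_corridor unfolding fundamental_flat_def by auto
  obtain C where C: "circuit M C" "spanning M C" "basis (restriction M X) (X \<inter> C)"
    using assms unfolding fundamental_flat_def by blast
  define B where "B = X \<inter> C"
  have X_sub: "X \<subseteq> {1..n}" using flat unfolding flat_def by simp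
  then have finX: "finite X" by (auto intro: finite_subset)
  have C_sub: "C \<subseteq> {1..n}" using C(1) unfolding circuit_def by simp
  have B: "indep M B" "B \<subseteq> X" "\<And>B'. indep M B' \<Longrightarrow> B' \<subseteq> X \<Longrightarrow> B \<subseteq> B' \<Longrightarrow> B' = B"
    using C(3) unfolding B_def basis_def restriction_def by auto
  have B_sub: "B \<subseteq> {1..n}" using B(2) X_sub by blast
  have card_B: "card B < r"
    using card_basis_restriction[OF matroid_corridor finX C(3)] rank B_def by simp
  have B0n: "B \<inter> {0<..n} = B" using B_sub by auto
  have C0n: "C \<inter> {0<..n} = C" using C_sub by auto
  have span: "y \<in> X" if "y \<in> {1..n}" "\<not> indep M (insert y B)" for y
  proof (rule ccontr)
    assume "y \<notin> X"
    then have "rank M X < rank M (insert y X)" using flat that(1) unfolding flat_def by simp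
    then show False
      using matroid_basis_restriction_insert[OF matroid_corridor finX C(3)] that(2) B_def by simp
  qed
  \<comment> \<open>These are the full windows that start at \<open>0\<close> or end at
    \<open>n\<close>. Any element of such a window is spanned by \<open>B\<close> and so lies in the
    flat \<open>X\<close>.\<close>
  define tight_left where "tight_left = {t. t \<le> n \<and> card (B \<inter> {0<..t}) = b t}"
  define tight_right where "tight_right = {s. s \<le> n \<and> card (B \<inter> {s<..n}) + a s = r}"
  have left_sub: "{0<..t} \<subseteq> X" if t: "t \<in> tight_left" for t
  proof
    fix y assume y: "y \<in> {0<..t}"
    show "y \<in> X"
    proof (cases "y \<in> B")
      case False
      have "insert y B \<inter> {0<..t} = insert y (B \<inter> {0<..t})" using y by auto
      then have "card (insert y B \<inter> {0<..t}) = Suc (b t)"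
        using t False by (simp add: tight_left_def)
      then have "\<not> indep M (insert y B)"
        using indep_corridor_matroid_le[of n a b "insert y B" 0 t] t tight_left_def by auto
      then show ?thesis using span y t by (auto simp: tight_left_def)
    qed (use B(2) in blast)
  qed
  have right_sub: "{s<..n} \<subseteq> X" if s: "s \<in> tight_right" for s
  proof
    fix y assume y: "y \<in> {s<..n}"
    show "y \<in> X"
    proof (cases "y \<in> B")
      case False
      have "insert y B \<inter> {s<..n} = insert y (B \<inter> {s<..n})" using y by auto
      then have "card (insert y B \<inter> {s<..n}) + a s = Suc r"
        using s False by (simp add: tight_right_def)
      then have "\<not> indep M (insert y B)"
        using indep_corridor_matroid_le[of n a b "insert y B" s n] s bn tight_right_def by auto
      then show ?thesis using span y by auto
    qed (use B(2) in blast)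
  qed
  have cover: "(\<exists>t \<in> tight_left. x \<le> t) \<or> (\<exists>s \<in> tight_right. s < x)" if x: "x \<in> X" "x \<notin> B" for x
  proof -
    have "\<not> indep M (insert x B)" using B(2) B(3)[of "insert x B"] x by auto
    then obtain s t where st: "s \<le> t" "t \<le> n" "b t < card (insert x B \<inter> {s<..t}) + a s"
      using x X_sub B_sub unfolding indep_corridor_matroid by (auto simp: not_le)
    have Bst: "card (B \<inter> {s<..t}) + a s \<le> b t" using indep_corridor_matroid_le[OF B(1) st(1,2)] .
    have xst: "x \<in> {s<..t}"
    proof (rule ccontr)
      assume "x \<notin> {s<..t}"
      then have "insert x B \<inter> {s<..t} = B \<inter> {s<..t}" by auto
      then show False using Bst st(3) by simp
    qed
    then have "insert x B \<inter> {s<..t} = insert x (B \<inter> {s<..t})" by auto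
    then have tight: "card (B \<inter> {s<..t}) + a s = b t" using Bst st(3) x(2) by simp
    have BC: "card (B \<inter> {s<..t}) \<le> card (C \<inter> {s<..t})"
      by (rule card_Int_mono) (auto simp: B_def)
    have split: "card (C \<inter> {0<..s}) + card (C \<inter> {s<..t}) + card (C \<inter> {t<..n}) = Suc r"
      using card_Int_split[of 0 s n C] card_Int_split[of s t n C] st C0n
        card_spanning_circuit[OF C(1,2)] by simp
    \<comment> \<open>After deletion of one element of \<open>C\<close>, at most
      \<open>r - a s\<close> elements remain after \<open>s\<close>. Since \<open>C\<close> has
      \<open>Suc r\<close> elements, enough are left up to \<open>s\<close>.\<close>
    have as: "a s \<le> card (C \<inter> {0<..s})"
    proof (cases "C \<inter> {0<..s} = {}")
      case True
      then have "card (C \<inter> {s<..n}) = Suc r" using split card_Int_split[of s t n C] st by simp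
      moreover have "C \<noteq> {}" using card_spanning_circuit[OF C(1,2)] by auto
      then obtain z where z: "z \<in> C" by blast
      then have "s < z" using True C_sub by force
      have "indep M (C - {z})" using C(1) z unfolding circuit_def by auto
      moreover have "(C - {z}) \<inter> {s<..n} = C \<inter> {s<..n} - {z}" by auto
      moreover have "z \<in> C \<inter> {s<..n}" using z \<open>s < z\<close> C_sub by auto
      ultimately have "r + a s \<le> b n"
        using indep_corridor_matroid_le[of n a b "C - {z}" s n] st by simp
      then show ?thesis using bn by simp
    next
      case False
      then show ?thesis
        using card_circuit_final_le[OF C(1), of s] split card_Int_split[of s t n C] st by simp
    qed
    consider "C \<inter> {0<..s} \<noteq> {}" "C \<inter> {t<..n} \<noteq> {}" | "C \<inter> {t<..n} = {}" | "C \<inter> {0<..s} = {}" "C \<inter> {t<..n} \<noteq> {}"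
      by blast
    then show ?thesis
    proof cases
      case 1
      \<comment> \<open>This case is impossible. Adding the two bounds counts all
        \<open>Suc r\<close> elements of \<open>C\<close> once and those in the window twice, so
        \<open>C\<close>, and with it \<open>B\<close>, leaves the window unfilled.\<close>
      have "card (C \<inter> {s<..n}) + a s \<le> r" using card_circuit_final_le[OF C(1) 1(1)] st by simp
      moreover have "card (C \<inter> {0<..t}) \<le> b t" using card_circuit_initial_le[OF C(1) 1(2)] st by simp
      ultimately show ?thesis
        using split tight BC card_Int_split[of s t n C] card_Int_split[of 0 s t C] st by simp
    next
      case 2
      have "B \<inter> {t<..n} = {}" using 2 B_def by blast
      then have Bs: "card (B \<inter> {s<..n}) = card (B \<inter> {s<..t})"
        using card_Int_split[of s t n B] st by simp
      \<comment> \<open>Deleting one element of \<open>C\<close> leaves \<open>r\<close> independent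
        elements in \<open>{1..t}\<close>. The window can therefore be extended to the end.\<close>
      have "r \<le> b t"
      proof -
        have "C \<noteq> {}" using card_spanning_circuit[OF C(1,2)] by auto
        then obtain z where z: "z \<in> C" by blast
        then have "indep M (C - {z})" using C(1) unfolding circuit_def by auto
        moreover have "C - {z} \<subseteq> {1..t}" using 2 C_sub by force
        ultimately have "card (C - {z}) \<le> b t" using card_indep_le st by blast
        then show ?thesis using card_spanning_circuit[OF C(1,2)] z by simp
      qed
      then have "b t = r" using mono_b[of t n] bn st by simp
      then have "s \<in> tight_right" using Bs tight st by (simp add: tight_right_def)
      then show ?thesis using xst by auto
    next
      case 3
      then have "a s = 0" using as by simp
      have "B \<inter> {0<..s} = {}" using 3(1) B_def by blast
      then have "card (B \<inter> {0<..t}) = card (B \<inter> {s<..t})"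
        using card_Int_split[of 0 s t B] st by simp
      then have "t \<in> tight_left" using tight \<open>a s = 0\<close> st by (simp add: tight_left_def)
      then show ?thesis using xst by auto
    qed
  qed
  have fin_l: "finite tight_left" and fin_r: "finite tight_right"
    unfolding tight_left_def tight_right_def by simp_all
  \<comment> \<open>The empty windows at both ends are full, so the maximum and the minimum below
    exist.\<close>
  have "0 \<in> tight_left" by (simp add: tight_left_def b0)
  have "n \<in> tight_right" by (simp add: tight_right_def an)
  define T where "T = Max tight_left"
  define S where "S = Min tight_right"
  have T: "T \<in> tight_left" "\<And>t. t \<in> tight_left \<Longrightarrow> t \<le> T"
    using fin_l \<open>0 \<in> tight_left\<close> unfolding T_def by (auto intro: Max_in)
  have S: "S \<in> tight_right" "\<And>s. s \<in> tight_right \<Longrightarrow> S \<le> s"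
    using fin_r \<open>n \<in> tight_right\<close> unfolding S_def by (auto intro: Min_in)
  have T': "T \<le> n" "card (B \<inter> {0<..T}) = b T" using T(1) by (simp_all add: tight_left_def)
  have S': "S \<le> n" "card (B \<inter> {S<..n}) + a S = r" using S(1) by (simp_all add: tight_right_def)
  \<comment> \<open>If the two full windows overlapped, adding their counts and bounding the overlap
    would give \<open>B\<close> at least \<open>r\<close> elements.\<close>
  have "T \<le> S"
  proof (rule ccontr)
    assume "\<not> T \<le> S"
    then have "S \<le> T" by simp
    then have "card (B \<inter> {S<..T}) + a S \<le> b T" using indep_corridor_matroid_le[OF B(1)] T'(1) by simp
    then show False
      using card_Int_split[of 0 S n B] card_Int_split[of 0 S T B] card_Int_split[of S T n B]
        \<open>S \<le> T\<close> T' S' B0n card_B by simp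
  qed
  have middle: "x \<in> B" if "x \<in> X" "T < x" "x \<le> S" for x
    using cover[OF that(1)] T(2) S(2) that by (metis leD le_less_trans le_trans)
  have card_B_split: "card B = b T + card (B \<inter> {T<..S}) + card (B \<inter> {S<..n})"
    using card_Int_split[of 0 T n B] card_Int_split[of T S n B] \<open>T \<le> S\<close> T' S' B0n by simp
  \<comment> \<open>Windows are cut at \<open>T\<close> and \<open>S\<close>. Between these points
    \<open>D\<close> is contained in \<open>B\<close>, and fullness at \<open>T\<close> or
    \<open>S\<close> turns the bounds for \<open>B\<close> on longer windows into bounds on the
    middle piece.\<close>
  have join: "indep M D"
    if D: "D \<subseteq> X" "indep M (D \<inter> {0<..T})" "indep M (D \<inter> {S<..n})" for D
    unfolding indep_corridor_matroid
  proof (intro conjI allI impI)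
    show "D \<subseteq> {1..n}" using D(1) X_sub by blast
    have dl: "card (D \<inter> {s<..t}) + a s \<le> b t" if "s \<le> t" "t \<le> T" for s t
    proof -
      have "D \<inter> {0<..T} \<inter> {s<..t} = D \<inter> {s<..t}" using that by auto
      then show ?thesis using indep_corridor_matroid_le[OF D(2), of s t] that T'(1) by simp
    qed
    have dr: "card (D \<inter> {s<..t}) + a s \<le> b t" if "s \<le> t" "S \<le> s" "t \<le> n" for s t
    proof -
      have "D \<inter> {S<..n} \<inter> {s<..t} = D \<inter> {s<..t}" using that by auto
      then show ?thesis using indep_corridor_matroid_le[OF D(3), of s t] that by simp
    qed
    have dm: "card (D \<inter> {s<..t}) \<le> card (B \<inter> {s<..t})" if "T \<le> s" "t \<le> S" for s t
      using middle D(1) that by (intro card_mono) auto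
    fix s t :: nat assume st: "s \<le> t" "t \<le> n"
    consider "t \<le> T" | "S \<le> s" | "s \<le> T" "S \<le> t" | "s \<le> T" "T \<le> t" "t \<le> S"
      | "T \<le> s" "s \<le> S" "S \<le> t" | "T \<le> s" "t \<le> S" by linarith
    then show "card (D \<inter> {s<..t}) + a s \<le> b t"
    proof cases
      case 1 then show ?thesis using dl st by simp
    next
      case 2 then show ?thesis using dr st by simp
    next
      case 3
      \<comment> \<open>Since \<open>B\<close> has fewer than \<open>r\<close> elements,
        \<open>b T\<close> plus the number of middle elements of \<open>B\<close> is less than
        \<open>a S\<close>, so the three bounds combine.\<close>
      then show ?thesis
        using dl[of s T] dm[of T S] dr[of S t] card_Int_split[of s T t D] card_Int_split[of T S t D]
          \<open>T \<le> S\<close> st card_B_split card_B S'(2) by simp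
    next
      case 4
      then show ?thesis
        using dl[of s T] dm[of T t] card_Int_split[of s T t D] card_Int_split[of 0 T t B]
          indep_corridor_matroid_le[OF B(1), of 0 t] T' st a0 by simp
    next
      case 5
      then show ?thesis
        using dr[of S t] dm[of s S] card_Int_split[of s S t D] card_Int_split[of s S n B]
          indep_corridor_matroid_le[OF B(1), of s n] S' st bn by simp
    next
      case 6
      then show ?thesis
        using dm[of s t] indep_corridor_matroid_le[OF B(1) st] by simp
    qed
  qed
  have circ: "D \<subseteq> {0<..T} \<or> D \<subseteq> {S<..n}" if D: "circuit M D" "D \<subseteq> X" for D
  proof (rule ccontr)
    assume "\<not> (D \<subseteq> {0<..T} \<or> D \<subseteq> {S<..n})"
    then have "D \<inter> {0<..T} \<subset> D" "D \<inter> {S<..n} \<subset> D" by blast+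
    then have "indep M (D \<inter> {0<..T})" "indep M (D \<inter> {S<..n})"
      using D(1) unfolding circuit_def by blast+
    then have "indep M D" by (rule join[OF D(2)])
    then show False using D(1) unfolding circuit_def by simp
  qed
  have conn': "x \<in> {0<..T} \<and> y \<in> {0<..T} \<or> x \<in> {S<..n} \<and> y \<in> {S<..n}"
    if "x \<in> X" "y \<in> X" "x \<noteq> y" for x y
  proof -
    have "x \<in> ground (restriction M X)" "y \<in> ground (restriction M X)"
      using that X_sub by (auto simp: restriction_def)
    then obtain D where "circuit M D" "D \<subseteq> X" "x \<in> D" "y \<in> D"
      using conn \<open>x \<noteq> y\<close> unfolding connected_matroid_def circuit_restriction_iff by blast
    then show ?thesis using circ by blast
  qed
  obtain x y where xy: "x \<in> X" "y \<in> X" "x \<noteq> y"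
    using card_X card_le_Suc0_iff_eq[OF finX] by force
  have disj: "z \<notin> {S<..n}" if "z \<in> {0<..T}" for z using that \<open>T \<le> S\<close> by auto
  \<comment> \<open>Any two elements of \<open>X\<close> share an outer part. These parts are
    disjoint, so the one containing \<open>x\<close> and \<open>y\<close> contains all of
    \<open>X\<close>.\<close>
  have "X \<subseteq> {0<..T} \<or> X \<subseteq> {S<..n}"
    using conn'[OF xy] conn'[of x] conn'[of y] xy disj by blast
  then have "X = {0<..T} \<or> X = {S<..n}" using left_sub[OF T(1)] right_sub[OF S(1)] by blast
  moreover have "{0<..T} = {1..T}" by auto
  ultimately show ?thesis using that T'(1) S'(1) by metis
qed

theorem fundamental_flat_iff:
  "fundamental_flat M X \<longleftrightarrow>
    (\<exists>i. X = {1..i} \<and> 0 < i \<and> i < n \<and> b i = b (i - 1) \<and> b (Suc i) = Suc (b i)) \<or>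
    (\<exists>j. X = {j<..n} \<and> 0 < j \<and> j < n \<and> a j = Suc (a (j - 1)) \<and> a (Suc j) = a j)"
proof
  assume X: "fundamental_flat M X"
  then obtain t where "t \<le> n" "X = {1..t} \<or> X = {t<..n}" by (rule fundamental_flat_interval)
  then show "(\<exists>i. X = {1..i} \<and> 0 < i \<and> i < n \<and> b i = b (i - 1) \<and> b (Suc i) = Suc (b i)) \<or>
    (\<exists>j. X = {j<..n} \<and> 0 < j \<and> j < n \<and> a j = Suc (a (j - 1)) \<and> a (Suc j) = a j)"
    using X fundamental_flat_initialD fundamental_flat_finalD by blast
qed (use fundamental_flat_initial fundamental_flat_final in blast)

end

section \<open>Lattice paths\<close>

definition height :: "step list \<Rightarrow> nat \<Rightarrow> nat" where
  "height w t = count_list (take t w) N"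

definition width :: "step list \<Rightarrow> nat \<Rightarrow> nat" where
  "width w t = count_list (take t w) E"

lemma vertex_eq: "vertex w t = (width w t, height w t)"
  by (simp add: vertex_def width_def height_def)

lemma
  assumes "t < length w"
  shows height_Suc: "height w (Suc t) = (if w ! t = N then Suc (height w t) else height w t)"
    and width_Suc: "width w (Suc t) = (if w ! t = N then width w t else Suc (width w t))"
  using assms by (cases "w ! t"; simp add: height_def width_def take_Suc_conv_app_nth)+

lemma height_0 [simp]: "height w 0 = 0" and width_0 [simp]: "width w 0 = 0"
  by (simp_all add: height_def width_def)

lemma unit_steps_height: "unit_steps (length w) (height w)"
  unfolding unit_steps_def by (simp add: height_Suc)

lemma unit_steps_width: "unit_steps (length w) (width w)"
  unfolding unit_steps_def by (simp add: width_Suc)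

lemma width_plus_height: "t \<le> length w \<Longrightarrow> width w t + height w t = t"
  by (induction t) (simp_all add: height_Suc width_Suc)

lemma lattice_path_to_iff:
  "lattice_path_to (m, r) w \<longleftrightarrow> length w = m + r \<and> height w (m + r) = r"
  using width_plus_height[of "length w" w] unfolding lattice_path_to_def vertex_eq by auto

lemma unit_steps_intermediate:
  assumes "unit_steps n c" "s \<le> t" "t \<le> n" "c s \<le> v" "v \<le> c t"
  shows "\<exists>u. s \<le> u \<and> u \<le> t \<and> c u = v"
  using assms(2,3,5)
proof (induction t rule: dec_induct)
  case base
  then show ?case using assms(4) by auto
next
  case (step t)
  show ?case
  proof (cases "v \<le> c t")
    case True
    then obtain u where "s \<le> u" "u \<le> t" "c u = v" using step by auto
    then show ?thesis by (intro exI[of _ u]) simp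
  next
    case False
    then have "c (Suc t) = v" using unit_stepsD[OF assms(1), of t] step by auto
    then show ?thesis using step.hyps by (intro exI[of _ "Suc t"]) simp
  qed
qed

lemma in_vertices_iff: "(x, y) \<in> vertices w \<longleftrightarrow> (\<exists>t\<le>length w. x = width w t \<and> y = height w t)"
  unfolding vertices_def vertex_eq by auto

section \<open>Comparison of paths by columns and by antidiagonals\<close>

lemma
  shows goes_above_columns: "goes_above v w \<longleftrightarrow>
      (\<exists>t\<le>length v. \<forall>s\<le>length w. width w s = width v t \<longrightarrow> height w s < height v t)"
    and goes_below_columns: "goes_below v w \<longleftrightarrow>
      (\<exists>t\<le>length v. \<forall>s\<le>length w. width w s = width v t \<longrightarrow> height v t < height w s)"
  unfolding goes_above_def goes_below_def in_vertices_iff by metis+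

text \<open>Columns and antidiagonals give the same comparison of two paths with common endpoints.\<close>

lemma
  assumes v: "lattice_path_to (m, r) v" and w: "lattice_path_to (m, r) w"
  shows goes_above_iff: "goes_above v w \<longleftrightarrow> (\<exists>t\<le>m + r. height w t < height v t)" (is "?A \<longleftrightarrow> ?B")
    and goes_below_iff: "goes_below v w \<longleftrightarrow> (\<exists>t\<le>m + r. height v t < height w t)" (is "?C \<longleftrightarrow> ?D")
proof -
  have len: "length v = m + r" "length w = m + r" using v w by (simp_all add: lattice_path_to_iff)
  have eq: "width v t + height v t = t" "width w t + height w t = t" if "t \<le> m + r" for t
    using that len width_plus_height by metis+
  have mono: "width w s \<le> width w t" "height w s \<le> height w t" if "s \<le> t" "t \<le> m + r" for s t
    using unit_steps_mono[OF unit_steps_width, of s t w] unit_steps_mono[OF unit_steps_height, of s t w]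
      that len by simp_all
  have ends: "width v (m + r) = m" "width w (m + r) = m"
    using v w eq[of "m + r"] by (simp_all add: lattice_path_to_iff)
  have width_le: "width v t \<le> m" if "t \<le> m + r" for t
    using unit_steps_mono[OF unit_steps_width, of t "m + r" v] ends len that by simp
  show "?A \<longleftrightarrow> ?B"
  proof
    assume ?A
    then obtain t where t: "t \<le> m + r"
        "\<And>s. s \<le> m + r \<Longrightarrow> width w s = width v t \<Longrightarrow> height w s < height v t"
      unfolding goes_above_columns len by blast
    show ?B
    proof (rule ccontr)
      assume "\<not> ?B"
      then have "height v t \<le> height w t" using t(1) by (simp add: not_less)
      then have "width w t \<le> width v t" using eq[OF t(1)] by linarith
      \<comment> \<open>At time \<open>t\<close>, \<open>w\<close> is not yet past the column of
        \<open>v\<close>, so it meets that column at \<open>t\<close> or later, at a height not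
        below that of \<open>v\<close>.\<close>
      then obtain s where "t \<le> s" "s \<le> m + r" "width w s = width v t"
        using unit_steps_intermediate[OF unit_steps_width, of t "m + r" w "width v t"]
          t(1) len ends width_le by auto
      then show False
        using t(2)[of s] mono(2)[of t s] \<open>height v t \<le> height w t\<close> by simp
    qed
  next
    assume ?B
    then obtain t where t: "t \<le> m + r" "height w t < height v t" by blast
    have "height w s < height v t" if s: "s \<le> m + r" "width w s = width v t" for s
    proof -
      \<comment> \<open>On the same antidiagonal, the lower path is further to the right, so
        \<open>w\<close> visited this column earlier and lower.\<close>
      have "width w s < width w t" using eq[OF t(1)] t(2) s by linarith
      then have "s \<le> t" using mono(1)[of t s] s by (meson leD nat_le_linear)
      then show ?thesis using mono(2)[of s t] t by simp
    qed
    then show ?A unfolding goes_above_columns len using t(1) by blast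
  qed
  show "?C \<longleftrightarrow> ?D"
  proof
    assume ?C
    then obtain t where t: "t \<le> m + r"
        "\<And>s. s \<le> m + r \<Longrightarrow> width w s = width v t \<Longrightarrow> height v t < height w s"
      unfolding goes_below_columns len by blast
    show ?D
    proof (rule ccontr)
      assume "\<not> ?D"
      then have "height w t \<le> height v t" using t(1) by (simp add: not_less)
      then have "width v t \<le> width w t" using eq[OF t(1)] by linarith
      then obtain s where "s \<le> t" "width w s = width v t"
        using unit_steps_intermediate[OF unit_steps_width, of 0 t w "width v t"] t(1) len by auto
      then show False
        using t(1) t(2)[of s] mono(2)[of s t] \<open>height w t \<le> height v t\<close> by simp
    qed
  next
    assume ?D
    then obtain t where t: "t \<le> m + r" "height v t < height w t" by blast
    have "height v t < height w s" if s: "s \<le> m + r" "width w s = width v t" for s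
    proof -
      have "width w t < width w s" using eq[OF t(1)] t(2) s by linarith
      then have "t \<le> s" using mono(1)[of s t] t by (meson leD nat_le_linear)
      then show ?thesis using mono(2)[of t s] t s by simp
    qed
    then show ?C unfolding goes_below_columns len using t(1) by blast
  qed
qed

section \<open>Sets of North steps as intervals\<close>

lemma exists_path_of_height:
  assumes "unit_steps n c" "c 0 = 0"
  obtains w where "length w = n" "\<And>t. t \<le> n \<Longrightarrow> height w t = c t"
proof -
  define w where "w = map (\<lambda>t. if c (Suc t) = c t then E else N) [0..<n]"
  have len: "length w = n" by (simp add: w_def)
  have "height w t = c t" if "t \<le> n" for t
    using that
  proof (induction t)
    case (Suc t)
    then have "w ! t = (if c (Suc t) = c t then E else N)" by (simp add: w_def)
    then show ?case
      using Suc unit_stepsD[OF assms(1), of t] height_Suc[of t w] len by auto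
  qed (simp add: assms(2))
  then show ?thesis using that len by blast
qed

text \<open>The height of a path between \<open>P\<close> and \<open>Q\<close> goes from
  \<open>i - 1\<close> to \<open>i\<close> at its \<open>i\<close>-th North step, which gives both
  bounds. Conversely, a path with such a step at \<open>x\<close> is obtained by clamping a single
  jump between the two borders.\<close>

lemma north_set_eq:
  assumes P: "lattice_path_to (m, r) P" and Q: "lattice_path_to (m, r) Q"
    and "\<not> goes_above P Q"
  shows "north_set m r P Q i = {x \<in> {1..m + r}. height P (x - 1) < i \<and> i \<le> height Q x}"
proof (intro equalityI subsetI)
  fix x assume "x \<in> north_set m r P Q i"
  then obtain R where R: "lattice_path_to (m, r) R" "\<not> goes_above R Q" "\<not> goes_below R P"
      and x: "is_north_step R i x"
    unfolding north_set_def paths_between_def by blast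
  have len: "length R = m + r" using R(1) by (simp add: lattice_path_to_iff)
  have x': "1 \<le> x" "x \<le> m + r" "R ! (x - 1) = N" "height R x = i"
    using x len unfolding is_north_step_def height_def by auto
  then have "i = Suc (height R (x - 1))" using height_Suc[of "x - 1" R] len by simp
  moreover have "height P (x - 1) \<le> height R (x - 1)" "height R x \<le> height Q x"
    using R(2,3) x' unfolding goes_above_iff[OF R(1) Q] goes_below_iff[OF R(1) P]
    by (auto simp: not_less)
  ultimately show "x \<in> {x \<in> {1..m + r}. height P (x - 1) < i \<and> i \<le> height Q x}"
    using x' by simp
next
  fix x assume "x \<in> {x \<in> {1..m + r}. height P (x - 1) < i \<and> i \<le> height Q x}"
  then have x: "1 \<le> x" "x \<le> m + r" "height P (x - 1) < i" "i \<le> height Q x" by auto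
  have len: "length P = m + r" "length Q = m + r" using P Q by (simp_all add: lattice_path_to_iff)
  have steps: "unit_steps (m + r) (height P)" "unit_steps (m + r) (height Q)"
    using unit_steps_height len by metis+
  have PQ: "height P t \<le> height Q t" if "t \<le> m + r" for t
    using assms(3) that unfolding goes_above_iff[OF P Q] by (simp add: not_less)
  \<comment> \<open>The jump from \<open>i - 1\<close> to \<open>i\<close> at \<open>x\<close> is
    forced between the heights of \<open>P\<close> and \<open>Q\<close>. At \<open>x - 1\<close> and
    \<open>x\<close> the bounds on \<open>i\<close> make the clamping inactive, and at
    \<open>0\<close> it yields height \<open>0\<close>.\<close>
  let ?l = "\<lambda>t. if t < x then i - 1 else i"
  let ?c = "\<lambda>t. max (height P t) (min (height Q t) (?l t))"
  have "unit_steps (m + r) ?l" unfolding unit_steps_def using x(3) by auto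
  then have "unit_steps (m + r) ?c"
    using steps by (intro unit_steps_max unit_steps_min)
  moreover have "?c 0 = 0" by simp
  ultimately obtain R where R: "length R = m + r" "\<And>t. t \<le> m + r \<Longrightarrow> height R t = ?c t"
    by (rule exists_path_of_height) blast
  have R_to: "lattice_path_to (m, r) R"
    using R P Q by (simp add: lattice_path_to_iff)
  have "\<not> goes_above R Q" "\<not> goes_below R P"
    unfolding goes_above_iff[OF R_to Q] goes_below_iff[OF R_to P]
    using R(2) PQ by (auto simp: not_less)
  moreover have "is_north_step R i x"
  proof -
    have P_step: "height P x \<le> Suc (height P (x - 1))" and Q_step: "height Q x \<le> Suc (height Q (x - 1))"
      using unit_stepsD[OF steps(1), of "x - 1"] unit_stepsD[OF steps(2), of "x - 1"] x by force+
    have "height R x = i" using R(2)[of x] P_step x by simp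
    moreover have "height R (x - 1) = i - 1" using R(2)[of "x - 1"] Q_step x by simp
    ultimately have "height R (x - 1) \<noteq> height R x" using x(3) by linarith
    moreover have "x - 1 < length R" "Suc (x - 1) = x" using R(1) x(1,2) by simp_all
    ultimately have "R ! (x - 1) = N"
      using height_Suc[of "x - 1" R] by metis
    then show ?thesis
      using \<open>height R x = i\<close> R(1) x unfolding is_north_step_def height_def by simp
  qed
  ultimately show "x \<in> north_set m r P Q i"
    unfolding north_set_def paths_between_def using R_to by blast
qed

lemma corridor_lattice_paths:
  assumes P: "lattice_path_to (m, r) P" and Q: "lattice_path_to (m, r) Q"
    and "\<not> goes_above P Q"
  shows "corridor (m + r) r (height P) (height Q)"
proof
  show "unit_steps (m + r) (height P)" "unit_steps (m + r) (height Q)"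
    using P Q unit_steps_height by (metis lattice_path_to_iff)+
  show "height P t \<le> height Q t" if "t \<le> m + r" for t
    using assms(3) that unfolding goes_above_iff[OF P Q] by (simp add: not_less)
qed (use P Q in \<open>simp_all add: lattice_path_to_iff\<close>)

lemma lattice_path_matroid_eq_corridor_matroid:
  assumes "lattice_path_to (m, r) P" "lattice_path_to (m, r) Q" "\<not> goes_above P Q"
  shows "lattice_path_matroid m r P Q = corridor_matroid (m + r) (height P) (height Q)"
  unfolding corridor.corridor_matroid_eq_transversal[OF corridor_lattice_paths[OF assms]]
    lattice_path_matroid_def
  using north_set_eq[OF assms] by (metis (no_types, lifting) ext)

section \<open>Corners in terms of heights, and the fundamental flats\<close>

lemma EN_corner_iff:
  "EN_corner w s \<longleftrightarrow> 0 < s \<and> s < length w \<and> height w s = height w (s - 1) \<and>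
    height w (Suc s) = Suc (height w s)"
proof -
  have "w ! (s - 1) = E \<longleftrightarrow> height w s = height w (s - 1)"
      "w ! s = N \<longleftrightarrow> height w (Suc s) = Suc (height w s)" if "0 < s" "s < length w"
    using that height_Suc[of "s - 1" w] height_Suc[of s w] by (cases "w ! (s - 1)"; auto)+
  then show ?thesis unfolding EN_corner_def by auto
qed

lemma NE_corner_iff:
  "NE_corner w s \<longleftrightarrow> 0 < s \<and> s < length w \<and> height w s = Suc (height w (s - 1)) \<and>
    height w (Suc s) = height w s"
proof -
  have "w ! (s - 1) = N \<longleftrightarrow> height w s = Suc (height w (s - 1))"
      "w ! s = E \<longleftrightarrow> height w (Suc s) = height w s" if "0 < s" "s < length w"
    using that height_Suc[of "s - 1" w] height_Suc[of s w] by (cases "w ! s"; auto)+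
  then show ?thesis unfolding NE_corner_def by auto
qed

theorem theorem5p3:
  fixes m r h k :: nat
    and P Q :: "step list"
    and M :: "nat indep_system"
    and i j :: "nat \<Rightarrow> nat"
  assumes "lattice_path_to (m, r) P"
    and "lattice_path_to (m, r) Q"
    and "\<not> goes_above P Q"
    and "M = lattice_path_matroid m r P Q"
    and "connected_matroid M"
    and "matroid_rank M = r"
    and "nullity M = m"
    and "strict_mono_on {1..h} i"
    and "i ` {1..h} = {s. EN_corner Q s}"
    and "strict_mono_on {1..k} j"
    and "j ` {1..k} = {s + 1 |s. NE_corner P s}"
  shows "{X. fundamental_flat M X} =
           {{1..i t} |t. t \<in> {1..h}} \<union> {{j t..m + r} |t. t \<in> {1..k}} \<and>
         (\<forall>s \<in> {1..h}. \<forall>t \<in> {1..h}. s < t \<longrightarrow> {1..i s} \<subset> {1..i t}) \<and>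
         (\<forall>s \<in> {1..k}. \<forall>t \<in> {1..k}. s < t \<longrightarrow> {j t..m + r} \<subset> {j s..m + r})"
proof -
  interpret corridor "m + r" r "height P" "height Q"
    using assms(1-3) by (rule corridor_lattice_paths)
  have M: "M = corridor_matroid (m + r) (height P) (height Q)"
    using lattice_path_matroid_eq_corridor_matroid assms(1-4) by simp
  interpret strict_corridor "m + r" r "height P" "height Q"
    by unfold_locales (use connected_imp_strict assms(5) M in simp)
  have len: "length P = m + r" "length Q = m + r"
    using assms(1,2) by (simp_all add: lattice_path_to_iff)
  have Q_corner: "EN_corner Q (i t)" if "t \<in> {1..h}" for t
  proof -
    have "i t \<in> {s. EN_corner Q s}" using imageI[OF that, of i] unfolding assms(9) .
    then show ?thesis by simp
  qed
  have P_corner: "\<exists>s. j t = Suc s \<and> NE_corner P s" if "t \<in> {1..k}" for t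
  proof -
    have "j t \<in> {s + 1 |s. NE_corner P s}" using imageI[OF that, of j] unfolding assms(11) .
    then show ?thesis by auto
  qed
  have "fundamental_flat M X \<longleftrightarrow>
      (\<exists>s. X = {1..s} \<and> EN_corner Q s) \<or> (\<exists>s. X = {s<..m + r} \<and> NE_corner P s)" for X
    unfolding M fundamental_flat_iff EN_corner_iff NE_corner_iff len ..
  then have "{X. fundamental_flat M X} =
      {{1..s} |s. EN_corner Q s} \<union> {{s<..m + r} |s. NE_corner P s}"
    by auto
  moreover have "{{1..s} |s. EN_corner Q s} = {{1..i t} |t. t \<in> {1..h}}"
    unfolding setcompr_eq_image assms(9)[symmetric] image_image Collect_mem_eq by (rule refl)
  \<comment> \<open>A corner of \<open>P\<close> at \<open>s\<close> gives the segment that begins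
    with the East step \<open>s + 1\<close>, and \<open>j\<close> enumerates exactly these
    beginnings.\<close>
  moreover have "{{s<..m + r} |s. NE_corner P s} = {{j t..m + r} |t. t \<in> {1..k}}"
  proof -
    have "{{s<..m + r} |s. NE_corner P s} = (\<lambda>u. {u..m + r}) ` {s + 1 |s. NE_corner P s}"
      by (simp add: setcompr_eq_image image_image atLeastSucAtMost_greaterThanAtMost)
    then show ?thesis
      unfolding assms(11)[symmetric] image_image setcompr_eq_image Collect_mem_eq .
  qed
  moreover have "{1..i s} \<subset> {1..i t}" if "s \<in> {1..h}" "t \<in> {1..h}" "s < t" for s t
  proof -
    have "i s < i t" using strict_mono_onD[OF assms(8)] that by blast
    moreover have "0 < i t" using Q_corner[OF that(2)] by (simp add: EN_corner_iff)
    ultimately show ?thesis by (simp add: psubset_eq)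
  qed
  moreover have "{j t..m + r} \<subset> {j s..m + r}" if "s \<in> {1..k}" "t \<in> {1..k}" "s < t" for s t
  proof -
    have "j s < j t" using strict_mono_onD[OF assms(10)] that by blast
    \<comment> \<open>This bound makes the inclusion proper; beyond \<open>m + r\<close> both
      segments would be empty.\<close>
    moreover have "j t \<le> m + r" using P_corner[OF that(2)] len by (auto simp: NE_corner_iff)
    ultimately show ?thesis by (simp add: psubset_eq)
  qed
  ultimately show ?thesis by simp
qed

end
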